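(* Let $d\ge2$ be an integer and let $\beta$ be a positive integer $M$. Then $$\mathcal{K}_M(\mathbf{x},\mathbf{y})=\mathcal{Q}_{M-1}(\mathbf{x},\mathbf{y})+(-1)^Mc_d(M)\,\|\mathbf{x}-\mathbf{y}\|^{2M-1},\qquad\mathbf{x},\mathbf{y}\in\mathbb{S}^d,$$ where $\mathcal{Q}_{M-1}(\mathbf{x},\mathbf{y})$ is the following polynomial of degree $M-1$ in terms of $\mathbf{x}\cdot\mathbf{y}$, $$\mathcal{Q}_{M-1}(\mathbf{x},\mathbf{y})=\frac{2^{2M-1}}{2M-1}\frac{(d/2)_{2M-1}}{(d)_{2M-1}}\;{}_3F_2\!\left(1-M,\tfrac12-M,1-M;\ \tfrac32-M,2-\tfrac d2-2M;\ \frac{1-\mathbf{x}\cdot\mathbf{y}}2\right),$$ and the positive constant $c_d(M)$ is given by $$c_d(M)=2^{-2M}\,\frac{\Gamma((d+1)/2)}{\sqrt\pi\,\Gamma(d/2)}\,\frac{\Gamma(M)\Gamma(M)}{(1/2)_M(d/2)_M}.$$ Moreover, $$\int_{\mathbb{S}^d}\int_{\mathbb{S}^d}\mathcal{Q}_{M-1}(\mathbf{x},\mathbf{y})\,\mathrm{d}\sigma_d(\mathbf{x})\,\mathrm{d}\sigma_d(\mathbf{y})=(-1)^{M-1}\frac{(M-1)!}{(3/2)_{M-1}}\;{}_4F_3\!\left(1-M,\tfrac12-M,M+d-1,\tfrac d2;\ 1-M,\tfrac{d+1}2,d;\ 1\right),$$ where the ${}_4F_3$ is a polynomial of degree $M-1$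 evaluated at $1$. For $d=2$ this relation becomes $$\int_{\mathbb{S}^2}\int_{\mathbb{S}^2}\mathcal{Q}_{M-1}(\mathbf{x},\mathbf{y})\,\mathrm{d}\sigma_2(\mathbf{x})\,\mathrm{d}\sigma_2(\mathbf{y})=\frac{2^{2M}}{M^2(2M+1)^2}+\frac{(-1)^{M-1}}{M(2M+1)^2}\frac{(M-1)!}{(1/2)_M}.$$
   Context: $\mathbb{S}^d$ is the unit sphere in $\mathbb{R}^{d+1}$, $\|\cdot\|$ is the Euclidean norm, and $\sigma_d$ is the normalized surface measure on $\mathbb{S}^d$ ($\sigma_d(\mathbb{S}^d)=1$). The truncated power is $u_+^{\alpha}=u^\alpha$ for $u>0$ and $u_+^\alpha=0$ for $u<0$ (with $u_+^0=1$ for $u\ge 0$). The kernel is $$\mathcal{K}_\beta(\mathbf{x},\mathbf{y}) = \int_{-1}^1\int_{\mathbb{S}^d} (\mathbf{x}\cdot\mathbf{z}-t)_+^{\beta-1}(\mathbf{y}\cdot\mathbf{z}-t)_+^{\beta-1}\,\mathrm{d}\sigma_d(\mathbf{z})\,\mathrm{d}t .$$ $(a)_n=a(a+1)\cdots(a+n-1)$ is the Pochhammer symbol and ${}_pF_q(a_1,\dots,a_p;b_1,\dots,b_q;z)=\sum_{n\ge0}\frac{(a_1)_n\cdots(a_p)_n}{(b_1)_n\cdots(b_q)_n}\frac{z^n}{n!}$ is the generalized hypergeometric function. An upper parameter $1-M$ means that the series terminates after the term $n=M-1$, also when $1-M$ occurs as a lower parameter; in the ${}_4F_3$ above the two parameters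 $1-M$ must not be "cancelled" into a non-terminating series: it means $\sum_{n=0}^{M-1}\frac{(1/2-M)_n(M+d-1)_n(d/2)_n}{((d+1)/2)_n(d)_n\,n!}$.
   Formalization: The closed form for d=2 is false as printed (for M=1 the double integral equals 1 but the printed right-hand side equals 2/3); the formal statement multiplies the printed right-hand side by (2M+1)/2. *)

theory Defs
  imports "HOL-Probability.Probability"
begin

text \<open>
  The normalized surface measure: the measure of \<open>A\<close> is the proportion of the unit ball
  occupied by the cone \<open>{r *\<^sub>R z | r z. 0 < r \<and> r < 1 \<and> z \<in> A}\<close>; see
  \<open>emeasure_sphere_measure\<close> below.
\<close>

definition sphere_measure :: "'a::euclidean_space measure" where
  "sphere_measure =
     restrict_space (distr (uniform_measure lborel (ball 0 1)) borel sgn) (sphere 0 1)"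

text \<open>The value at \<open>u = 0\<close> is \<open>1\<close> for exponent \<open>0\<close>; note that \<open>0 powr 0 = 0\<close>.\<close>

definition trunc_powr :: "real \<Rightarrow> real \<Rightarrow> real" where
  "trunc_powr u \<alpha> = (if u > 0 then u powr \<alpha> else if u = 0 \<and> \<alpha> = 0 then 1 else 0)"

definition sphere_kernel :: "real \<Rightarrow> 'a::euclidean_space \<Rightarrow> 'a \<Rightarrow> real" where
  "sphere_kernel \<beta> x y =
     (LINT t:{-1..1}|lborel. LINT z|sphere_measure.
        trunc_powr (x \<bullet> z - t) (\<beta> - 1) * trunc_powr (y \<bullet> z - t) (\<beta> - 1))"

text \<open>
  If an upper parameter is \<open>-m\<close>, all terms of index \<open>n > m\<close> vanish, even if \<open>-m\<close> is also a lower
  parameter: such terms have the form \<open>0 / 0 = 0\<close>; see \<open>hypergeometric_terminating\<close>.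
\<close>

definition hypergeometric :: "real list \<Rightarrow> real list \<Rightarrow> real \<Rightarrow> real" where
  "hypergeometric as bs z = eval_fps (fps_hypergeo as bs 1) z"

definition Q_kernel :: "nat \<Rightarrow> nat \<Rightarrow> 'a::real_inner \<Rightarrow> 'a \<Rightarrow> real" where
  "Q_kernel d M x y =
     2 ^ (2 * M - 1) / (2 * real M - 1) *
     (pochhammer (real d / 2) (2 * M - 1) / pochhammer (real d) (2 * M - 1)) *
     hypergeometric [1 - real M, 1 / 2 - real M, 1 - real M]
       [3 / 2 - real M, 2 - real d / 2 - 2 * real M] ((1 - x \<bullet> y) / 2)"

definition c_const :: "nat \<Rightarrow> nat \<Rightarrow> real" where
  "c_const d M =
     1 / 2 ^ (2 * M) * (Gamma ((real d + 1) / 2) / (sqrt pi * Gamma (real d / 2))) *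
     (Gamma (real M) * Gamma (real M) / (pochhammer (1 / 2) M * pochhammer (real d / 2) M))"

lemma space_sphere_measure [simp]: "space sphere_measure = sphere 0 1"
  by (simp add: sphere_measure_def space_restrict_space)

lemma sets_sphere_measure:
  "sets (sphere_measure :: 'a::euclidean_space measure) = sets (restrict_space borel (sphere 0 1))"
  by (simp add: sphere_measure_def sets_restrict_space)

lemma emeasure_sphere_measure:
  fixes A :: "'a::euclidean_space set"
  assumes A: "A \<in> sets borel" "A \<subseteq> sphere 0 1"
  shows "emeasure sphere_measure A =
    emeasure lborel {r *\<^sub>R z | r z. 0 < r \<and> r < 1 \<and> z \<in> A} / emeasure lborel (ball (0::'a) 1)"
proof -
  have eq: "ball 0 1 \<inter> sgn -` A = {r *\<^sub>R z | r z. 0 < r \<and> r < 1 \<and> z \<in> A}" (is "?L = ?R")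
  proof (intro equalityI subsetI)
    fix x assume x: "x \<in> ?L"
    then have "x \<noteq> 0" using A(2) by (auto simp: sgn_zero)
    then have "x = norm x *\<^sub>R sgn x" "0 < norm x" by (auto simp: sgn_div_norm)
    moreover have "norm x < 1" "sgn x \<in> A" using x by auto
    ultimately show "x \<in> ?R" by blast
  next
    fix x assume "x \<in> ?R"
    then obtain r z where rz: "x = r *\<^sub>R z" "0 < r" "r < 1" "z \<in> A" by auto
    moreover have "norm z = 1" using rz A(2) by auto
    ultimately show "x \<in> ?L" by (auto simp: sgn_div_norm)
  qed
  have [measurable]: "A \<in> sets borel" by fact
  have m: "sgn -` A \<in> sets (borel :: 'a measure)"
    using measurable_sets[OF borel_measurable_sgn A(1)] by simp
  have "emeasure sphere_measure A =
      emeasure (distr (uniform_measure lborel (ball 0 1)) borel sgn) A"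
    unfolding sphere_measure_def using A by (subst emeasure_restrict_space) auto
  also have "\<dots> = emeasure (uniform_measure lborel (ball 0 1)) (sgn -` A)"
    using A by (subst emeasure_distr) (auto simp: measurable_def space_uniform_measure 
       intro: borel_measurable_sgn m measurable_sets[OF borel_measurable_sgn, simplified])
  also have "\<dots> = emeasure lborel (ball 0 1 \<inter> sgn -` A) / emeasure lborel (ball (0::'a) 1)"
    using m by (subst emeasure_uniform_measure) auto
  finally show ?thesis by (simp add: eq)
qed

lemma prob_space_sphere_measure: "prob_space (sphere_measure :: 'a::euclidean_space measure)"
proof
  let ?C = "{r *\<^sub>R z | r z. 0 < r \<and> r < 1 \<and> z \<in> sphere (0::'a) 1}"
  have C: "?C = ball 0 1 - {0}"
  proof (intro equalityI subsetI)
    fix x assume x: "x \<in> ball (0::'a) 1 - {0}"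
    then have "x = norm x *\<^sub>R sgn x" "0 < norm x" "norm x < 1" "sgn x \<in> sphere 0 1"
      by (auto simp: sgn_div_norm)
    then show "x \<in> ?C" by blast
  qed auto
  have "emeasure lborel ?C = emeasure lborel (ball (0::'a) 1)"
    unfolding C by (subst emeasure_Diff) auto
  moreover have "emeasure lborel (ball (0::'a) 1) \<noteq> 0"
    using unit_ball_vol_pos[of "real DIM('a)"] less_imp_neq by (fastforce simp: emeasure_ball)
  moreover have "emeasure lborel (ball (0::'a) 1) \<noteq> \<infinity>"
    using emeasure_lborel_ball_finite[of 0 1] by (simp add: less_top)
  ultimately show "emeasure (sphere_measure :: 'a measure) (space sphere_measure) = 1"
    by (simp add: emeasure_sphere_measure ennreal_divide_self less_top)
qed

lemma hypergeometric_terminating: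
  assumes "- real m \<in> set as"
  shows "hypergeometric as bs z =
    (\<Sum>n\<le>m. (\<Prod>a\<leftarrow>as. pochhammer a n) / (\<Prod>b\<leftarrow>bs. pochhammer b n) * z ^ n / fact n)"
proof -
  have foldl: "foldl (\<lambda>r a. r * pochhammer a n) c xs = c * (\<Prod>a\<leftarrow>xs. pochhammer a n)"
    for n c and xs :: "real list"
    by (induction xs arbitrary: c) (simp_all add: mult.assoc)
  have nth: "fps_nth (fps_hypergeo as bs 1) n =
      (\<Prod>a\<leftarrow>as. pochhammer a n) / ((\<Prod>b\<leftarrow>bs. pochhammer b n) * fact n)" for n
    by (simp add: fps_hypergeo_def foldl)
  have "(\<Prod>a\<leftarrow>as. pochhammer a n) = 0" if "n > m" for n
    using assms that by (auto simp: prod_list_zero_iff pochhammer_of_nat_eq_0_iff intro!: image_eqI)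
  then have "hypergeometric as bs z =
      (\<Sum>n\<le>m. (\<Prod>a\<leftarrow>as. pochhammer a n) / ((\<Prod>b\<leftarrow>bs. pochhammer b n) * fact n) * z ^ n)"
    unfolding hypergeometric_def eval_fps_def nth by (intro suminf_finite) (auto simp: not_le)
  then show ?thesis by (simp add: field_simps)
qed

text \<open>
  The closed form published for the double integral of \<open>Q_kernel 2 M\<close> over the two-sphere lacks a
  factor \<open>(2 * M + 1) / 2\<close>. For \<open>M = 1\<close> the integral is \<open>1\<close>, the published expression is \<open>2 / 3\<close>:
\<close>

lemma double_integral_Q_kernel_1:
  "(LINT y|(sphere_measure :: 'a::euclidean_space measure). LINT x|sphere_measure.
      Q_kernel 2 1 x y) = 1"
proof -
  interpret prob_space "sphere_measure :: 'a measure"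
    by (rule prob_space_sphere_measure)
  have "Q_kernel 2 1 x y = 1" for x y :: 'a
    using hypergeometric_terminating[of 0] by (simp add: Q_kernel_def)
  then show ?thesis using prob_space by simp
qed

lemma published_closed_form_1:
  fixes M :: nat
  assumes "M = 1"
  shows "2 ^ (2 * M) / ((real M)\<^sup>2 * (2 * real M + 1)\<^sup>2) +
    (-1) ^ (M - 1) / (real M * (2 * real M + 1)\<^sup>2) * (fact (M - 1) / pochhammer (1 / 2) M) = 2 / 3"
  using assms by simp

end

theory Submission
  imports Defs
begin

text \<open>
  Write \<open>N = M - 1\<close>, \<open>a = x \<bullet> z\<close>, \<open>b = y \<bullet> z\<close>. Averaging the kernel over \<open>z\<close> and \<open>- z\<close> replaces the
  integral over \<open>t \<le> min a b\<close> by half the integral of \<open>((t - a) * (t - b)) ^ N\<close> over \<open>{-1..1}\<close> with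
  the gap between \<open>a\<close> and \<open>b\<close> removed. The gap contributes a Beta integral times
  \<open>\<bar>(x - y) \<bullet> z\<bar> ^ (2 * M - 1)\<close>, hence the odd power of the distance. The remaining part is a polynomial
  in \<open>a\<close> and \<open>b\<close> whose mixed moments follow from the power moments of \<open>\<alpha> * a + b\<close>; two Vandermonde sums
  turn it into the \<open>3F2\<close>. Its double integral is the coefficient of \<open>q ^ N\<close> in a product of two \<open>2F1\<close>
  series, and Euler's transformation of both factors yields the \<open>4F3\<close>. For \<open>d = 2\<close> an index shift
  makes the \<open>4F3\<close> a partial sum of a \<open>2F1\<close> with \<open>c = a + b + 1\<close>, which has a closed form.
\<close>

section \<open>Euler's transformation of the hypergeometric series\<close>

text \<open>Only powers of a single linear form can be averaged over the sphere directly: the mean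
  of \<open>(p \<bullet> z) ^ (2 * k)\<close> depends on \<open>norm p\<close> alone. For
  \<open>p = \<alpha> *\<^sub>R x + y\<close> one has
  \<open>(norm p)\<^sup>2 = (\<alpha> + 1)\<^sup>2 - 4 * \<alpha> * w\<close> with
  \<open>w = (1 - x \<bullet> y) / 2\<close>; this is the origin of the argument of the
  \<open>3F2\<close>, and comparing coefficients of \<open>\<alpha>\<close> recovers the mixed
  moments. The means come from the Gaussian measure, which is a product measure and radially
  symmetric at once: its marginals are known, and polar coordinates split off the sphere with a
  constant that exponent 0 determines. Of the two Vandermonde sums one is the binomial convolution
  at a fixed degree, the other a Chu-Vandermonde sum over the degrees. Euler's transformation is
  used for formal power series: the two powers of \<open>1 - X\<close> that it produces have
  opposite exponents and cancel, so no convergence is involved.\<close>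

text \<open>\<open>B\<close> stands for \<open>1 - X\<close> to the power
  \<open>s = c - a - b\<close>, and \<open>B1\<close>, \<open>B2\<close>, \<open>F1\<close>,
  \<open>F2\<close> for derivatives. Conjugation with \<open>B\<close> thus turns Gauss's operator
  for \<open>a\<close>, \<open>b\<close> into the one for \<open>c - a\<close>,
  \<open>c - b\<close>. With derivatives as independent symbols this is a ring identity; the extra
  factor \<open>u\<close> lets \<open>B1\<close> and \<open>B2\<close> be eliminated without
  division.\<close>

lemma hypergeometric_operator_mult:
  fixes X u s a b c B B1 B2 F F1 F2 :: "'a::comm_ring_1"
  assumes "u = 1 - X" "s = c - a - b" "u * B1 = - s * B" "u * B2 - B1 = - s * B1"
  shows "u * (X * u * (B2 * F + 2 * B1 * F1 + B * F2) + (c - (a + b + 1) * X) * (B1 * F + B * F1)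
           - a * b * (B * F)) =
     u * B * (X * u * F2 + (c - ((c - a) + (c - b) + 1) * X) * F1 - (c - a) * (c - b) * F)"
proof -
  have u: "u * (u * B2) = (1 - s) * (u * B1)" proof -
    have "u * B2 = (1 - s) * B1" using assms(4) by (simp add: algebra_simps)
    then have "u * (u * B2) = u * ((1 - s) * B1)" by simp
    then show ?thesis by (simp only: mult.left_commute)
  qed
  have "u * (X * u * (B2 * F + 2 * B1 * F1 + B * F2) + (c - (a + b + 1) * X) * (B1 * F + B * F1)
           - a * b * (B * F)) =
     X * (u * (u * B2)) * F + 2 * X * u * (u * B1) * F1 + X * u * u * B * F2 +
     (c - (a + b + 1) * X) * (u * B1) * F + (c - (a + b + 1) * X) * u * B * F1 - a * b * u * B * F"
    by (simp add: algebra_simps)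
  also have "\<dots> = u * B * (X * u * F2 + (c - ((c - a) + (c - b) + 1) * X) * F1 - (c - a) * (c - b) * F)"
    unfolding u assms(3) unfolding assms(1,2) by (simp add: algebra_simps)
  finally show ?thesis .
qed

text \<open>The series is the binomial series of \<open>1 - X\<close> with exponent
  \<open>- s\<close>; this equation represents the power in the sequel.\<close>

lemma fps_hypergeo_1_0_deriv:
  fixes s :: "'a::field_char_0"
  shows "(1 - fps_X) * fps_deriv (fps_hypergeo [s] [] 1) = fps_const s * fps_hypergeo [s] [] 1"
proof (rule fps_ext)
  fix n
  have r: "fps_nth (fps_hypergeo [s] [] 1) (Suc n) * of_nat (Suc n) = (s + of_nat n) * fps_nth (fps_hypergeo [s] [] 1) n" for n
  proof -
    have "(fact n + fact n * of_nat n :: 'a) = fact (Suc n)" by (simp add: algebra_simps)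
    then have "(fact n + fact n * of_nat n :: 'a) \<noteq> 0" by (metis fact_nonzero)
    then show ?thesis by (simp add: pochhammer_rec' divide_simps) (simp add: algebra_simps)
  qed
  have r0: "fps_nth (fps_hypergeo [s] [] 1) (Suc 0) = s"
    using r[of 0] by simp
  show "fps_nth ((1 - fps_X) * fps_deriv (fps_hypergeo [s] [] 1)) n =
        fps_nth (fps_const s * fps_hypergeo [s] [] 1) n"
  proof (cases n)
    case 0
    then show ?thesis using r0 by (simp add: left_diff_distrib)
  next
    case (Suc m)
    then show ?thesis using r[of n]
      by (simp add: left_diff_distrib algebra_simps del: fps_hypergeo_nth)
  qed
qed

text \<open>By the first-order equation the logarithmic derivatives of the two factors cancel. Power
  series have no zero divisors, so \<open>1 - fps_X\<close> can be removed, and in characteristic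
  zero a vanishing derivative leaves only the constant term.\<close>

lemma fps_hypergeo_1_0_mult_minus:
  fixes s :: "'a::field_char_0"
  shows "fps_hypergeo [s] [] 1 * fps_hypergeo [-s] [] 1 = 1"
proof -
  let ?A = "fps_hypergeo [s] [] 1" and ?B = "fps_hypergeo [-s] [] (1::'a)"
  have "(1 - fps_X) * fps_deriv (?A * ?B) =
      ?A * ((1 - fps_X) * fps_deriv ?B) + ((1 - fps_X) * fps_deriv ?A) * ?B"
    by (simp add: algebra_simps)
  also have "\<dots> = 0"
    unfolding fps_hypergeo_1_0_deriv fps_const_neg[symmetric] by (simp only: mult_minus_left mult_minus_right mult.commute mult.left_commute add.left_inverse)
  finally have "(1 - fps_X) * fps_deriv (?A * ?B) = 0" .
  moreover have "(1 - fps_X :: 'a fps) \<noteq> 0"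
    by (metis fps_X_neq_one right_minus_eq)
  ultimately have "fps_deriv (?A * ?B) = 0" by (metis mult_eq_0_iff)
  then have "?A * ?B = fps_const (fps_nth (?A * ?B) 0)"
    by (simp only: fps_deriv_eq_0_iff)
  also have "fps_nth (?A * ?B) 0 = 1" by simp
  finally show ?thesis by simp
qed

text \<open>Gauss's hypergeometric differential operator. The parameters enter as separate
  \<open>fps_const\<close> summands to fit the ring identity
  \<open>hypergeometric_operator_mult\<close>.\<close>

definition hypergeo_op :: "'a::field_char_0 \<Rightarrow> 'a \<Rightarrow> 'a \<Rightarrow> 'a fps \<Rightarrow> 'a fps" where
  "hypergeo_op a b c F = fps_X * (1 - fps_X) * fps_deriv (fps_deriv F) +
     (fps_const c - (fps_const a + fps_const b + 1) * fps_X) * fps_deriv F - fps_const a * fps_const b * F"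

lemma hypergeo_op_nth:
  "fps_nth (hypergeo_op a b c F) n =
     of_nat (Suc n) * (c + of_nat n) * fps_nth F (Suc n) - (a + of_nat n) * (b + of_nat n) * fps_nth F n"
proof (cases n)
  case 0
  have e: "hypergeo_op a b c F = fps_X * ((1 - fps_X) * fps_deriv (fps_deriv F) - (fps_const a + fps_const b + 1) * fps_deriv F)
   + fps_const c * fps_deriv F - fps_const (a * b) * F"
    by (simp add: hypergeo_op_def algebra_simps)
  show ?thesis unfolding e using 0 by simp
next
  case (Suc m)
  have e: "hypergeo_op a b c F = fps_X * (fps_deriv (fps_deriv F) - fps_X * fps_deriv (fps_deriv F)
     - fps_const (a + b + 1) * fps_deriv F)
   + fps_const c * fps_deriv F - fps_const (a * b) * F"
    by (simp add: hypergeo_op_def algebra_simps flip: fps_const_mult fps_const_add)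
  show ?thesis unfolding e using Suc
    by (cases m) (simp_all add: algebra_simps)
qed

text \<open>On coefficients Gauss's equation is a two-term recurrence. Its leading factor
  \<open>(n + 1) * (c + n)\<close> never vanishes by the assumption on \<open>c\<close>, so the
  constant term determines the solution.\<close>

lemma fps_hypergeo_2_1_unique:
  fixes F :: "'a::field_char_0 fps"
  assumes c: "\<And>n. c + of_nat n \<noteq> 0"
  shows "F = fps_hypergeo [a, b] [c] 1 \<longleftrightarrow> hypergeo_op a b c F = 0 \<and> fps_nth F 0 = 1"
proof
  assume F: "F = fps_hypergeo [a, b] [c] 1"
  show "hypergeo_op a b c F = 0 \<and> fps_nth F 0 = 1"
  proof -
    have "fps_nth (hypergeo_op a b c (fps_hypergeo [a, b] [c] 1)) n = 0" for n
    proof -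
      have "pochhammer c n \<noteq> 0" using c by (auto simp: pochhammer_eq_0_iff eq_neg_iff_add_eq_0)
      moreover have "(fact n + fact n * of_nat n :: 'a) = fact (Suc n)" by (simp add: algebra_simps)
      then have "(fact n + fact n * of_nat n :: 'a) \<noteq> 0" by (metis fact_nonzero)
      ultimately show ?thesis using c[of n]
        by (simp add: hypergeo_op_nth pochhammer_rec' divide_simps) (simp add: algebra_simps)
    qed
    then show ?thesis unfolding F by (auto simp: fps_eq_iff)
  qed
next
  assume F: "hypergeo_op a b c F = 0 \<and> fps_nth F 0 = 1"
  then have r: "of_nat (Suc n) * (c + of_nat n) * fps_nth F (Suc n) = (a + of_nat n) * (b + of_nat n) * fps_nth F n" for n
    by (metis eq_iff_diff_eq_0 fps_zero_nth hypergeo_op_nth)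
  have "fps_nth F n = fps_nth (fps_hypergeo [a, b] [c] 1) n" for n
  proof (induction n)
    case (Suc n)
    have "of_nat (Suc n) * (c + of_nat n) \<noteq> 0" using c[of n] by (simp del: of_nat_Suc)
    then have "fps_nth F (Suc n) = (a + of_nat n) * (b + of_nat n) * fps_nth F n / (of_nat (Suc n) * (c + of_nat n))"
      using r[of n] by (metis nonzero_mult_div_cancel_left)
    then show ?case by (simp add: Suc pochhammer_rec' mult_ac) (simp add: algebra_simps)
  qed (use F in simp)
  then show "F = fps_hypergeo [a, b] [c] 1" by (rule fps_ext)
qed

text \<open>Multiplication by \<open>1 - X\<close> to the power \<open>c - a - b\<close> carries
  solutions of Gauss's equation for \<open>c - a\<close>, \<open>c - b\<close> to solutions for
  \<open>a\<close>, \<open>b\<close>. Both sides have constant term 1, so uniqueness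
  applies.\<close>

lemma fps_hypergeo_Euler:
  fixes a b c :: "'a::field_char_0"
  assumes c: "\<And>n. c + of_nat n \<noteq> 0"
  shows "fps_hypergeo [a, b] [c] 1 = fps_hypergeo [a + b - c] [] 1 * fps_hypergeo [c - a, c - b] [c] 1"
proof -
  define s where "s = c - a - b"
  define B where "B = fps_hypergeo [a + b - c] [] (1::'a)"
  define F where "F = fps_hypergeo [c - a, c - b] [c] (1::'a)"
  have B1: "(1 - fps_X) * fps_deriv B = - fps_const s * B"
    unfolding B_def fps_hypergeo_1_0_deriv by (simp add: s_def)
  have B2: "(1 - fps_X) * fps_deriv (fps_deriv B) - fps_deriv B = - fps_const s * fps_deriv B"
    using arg_cong[OF B1, of fps_deriv] by (simp add: algebra_simps)
  have "hypergeo_op (c - a) (c - b) c F = 0"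
    using fps_hypergeo_2_1_unique[OF c] F_def by blast
  then have F: "fps_X * (1 - fps_X) * fps_deriv (fps_deriv F) + (fps_const c - ((fps_const c - fps_const a) + (fps_const c - fps_const b) + 1) * fps_X) *
       fps_deriv F - (fps_const c - fps_const a) * (fps_const c - fps_const b) * F = 0"
    unfolding hypergeo_op_def by (simp flip: fps_const_sub)
  have "(1 - fps_X) * hypergeo_op a b c (B * F) = 0"
    using hypergeometric_operator_mult[OF refl _ B1 B2, of "fps_const c" "fps_const a" "fps_const b" F "fps_deriv F" "fps_deriv (fps_deriv F)"]
    unfolding F by (simp add: hypergeo_op_def s_def algebra_simps)
  moreover have "(1 - fps_X :: 'a fps) \<noteq> 0"
    by (metis fps_X_neq_one right_minus_eq)
  ultimately have "hypergeo_op a b c (B * F) = 0" by simp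
  moreover have "fps_nth (B * F) 0 = 1" by (simp add: B_def F_def)
  ultimately have "B * F = fps_hypergeo [a, b] [c] 1"
    using fps_hypergeo_2_1_unique[OF c] by blast
  then show ?thesis by (simp add: B_def F_def)
qed

lemma fps_hypergeo_Euler_product:
  fixes a b c a' b' c' :: "'a::field_char_0"
  assumes "\<And>n. c + of_nat n \<noteq> 0" "\<And>n. c' + of_nat n \<noteq> 0" "a + b - c = - (a' + b' - c')"
  shows "fps_hypergeo [a, b] [c] 1 * fps_hypergeo [a', b'] [c'] 1 =
    fps_hypergeo [c - a, c - b] [c] 1 * fps_hypergeo [c' - a', c' - b'] [c'] 1"
proof -
  have "fps_hypergeo [a + b - c] [] 1 * fps_hypergeo [a' + b' - c'] [] 1 = 1"
    using fps_hypergeo_1_0_mult_minus[of "a' + b' - c'"] by (simp add: assms(3) mult.commute)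
  moreover have "(B * F) * (B' * F') = (B * B') * (F * F')" for B B' F F' :: "'a fps"
    by (simp only: mult.assoc mult.left_commute)
  ultimately show ?thesis
    unfolding fps_hypergeo_Euler[OF assms(1), of a b] fps_hypergeo_Euler[OF assms(2), of a' b'] by simp
qed

section \<open>Vandermonde sums and the coefficients of the polynomial part\<close>

text \<open>Duplication splits both \<open>(- n)_(2 l)\<close> and \<open>(2 l)!\<close>. The factor
  \<open>(1/2)_l\<close> of an even moment cancels, and a Chu-Vandermonde term remains. For either
  parity of \<open>n\<close> one of the two upper parameters is a nonpositive integer, which makes
  the sum terminate.\<close>

lemma binomial_double_pochhammer_half:
  "real (n choose (2 * l)) * pochhammer (1 / 2) l =
     pochhammer (- (real n / 2)) l * pochhammer (1 / 2 - real n / 2) l / fact l"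
proof -
  have "real (n choose (2 * l)) = pochhammer (- real n) (2 * l) / fact (2 * l)"
    by (simp add: binomial_gbinomial gbinomial_pochhammer)
  also have "pochhammer (- real n) (2 * l) =
      4 ^ l * pochhammer (- (real n / 2)) l * pochhammer (1 / 2 - real n / 2) l"
    using pochhammer_double[of "- (real n / 2)" l] by (simp add: power_mult)
  also have "fact (2 * l) = (4 ^ l * pochhammer (1 / 2) l * fact l :: real)"
    by (simp add: fact_double power_mult)
  finally show ?thesis
    using pochhammer_pos[of "1 / 2 :: real" l] by simp
qed

lemma Vandermonde_pochhammer_real:
  fixes c :: real
  assumes "c > 0"
  shows "(\<Sum>k\<le>n. pochhammer a k * pochhammer (- real n) k / (fact k * pochhammer c k)) =
    pochhammer (c - a) n / pochhammer c n"
  using Vandermonde_pochhammer[of n c a] assms by (simp add: atMost_atLeast0)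

lemma sum_binomial_even:
  fixes c :: real
  assumes c: "c > 0"
  shows "(\<Sum>j\<le>m. real ((2 * m) choose (2 * j)) * (pochhammer (1 / 2) j / pochhammer c j)) =
      pochhammer (c + real m - 1 / 2) m / pochhammer c m"
proof -
  have "(\<Sum>j\<le>m. real ((2 * m) choose (2 * j)) * (pochhammer (1 / 2) j / pochhammer c j)) =
      (\<Sum>j\<le>m. pochhammer (1 / 2 - real m) j * pochhammer (- real m) j / (fact j * pochhammer c j))"
  proof (rule sum.cong[OF refl])
    fix j
    show "real ((2 * m) choose (2 * j)) * (pochhammer (1 / 2) j / pochhammer c j) =
      pochhammer (1 / 2 - real m) j * pochhammer (- real m) j / (fact j * pochhammer c j)"
      using binomial_double_pochhammer_half[of "2 * m" j] by simp
  qed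
  also have "\<dots> = pochhammer (c + real m - 1 / 2) m / pochhammer c m"
    by (subst Vandermonde_pochhammer_real[OF c]) (simp add: algebra_simps)
  finally show ?thesis .
qed

lemma sum_binomial_odd:
  fixes c :: real
  assumes c: "c > 0"
  shows "(\<Sum>j\<le>m. real (Suc (2 * m) choose (2 * j)) * (pochhammer (1 / 2) j / pochhammer c j)) =
      pochhammer (c + real m + 1 / 2) m / pochhammer c m"
proof -
  have "(\<Sum>j\<le>m. real (Suc (2 * m) choose (2 * j)) * (pochhammer (1 / 2) j / pochhammer c j)) =
      (\<Sum>j\<le>m. pochhammer (- 1 / 2 - real m) j * pochhammer (- real m) j / (fact j * pochhammer c j))"
  proof (rule sum.cong[OF refl])
    fix j
    have half: "- (real (Suc (2 * m)) / 2) = - 1 / 2 - real m" "1 / 2 - real (Suc (2 * m)) / 2 = - real m"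
      by (simp_all add: field_simps)
    show "real (Suc (2 * m) choose (2 * j)) * (pochhammer (1 / 2) j / pochhammer c j) =
      pochhammer (- 1 / 2 - real m) j * pochhammer (- real m) j / (fact j * pochhammer c j)"
      using binomial_double_pochhammer_half[of "Suc (2 * m)" j, unfolded half] by (simp del: binomial_Suc_Suc)
  qed
  also have "\<dots> = pochhammer (c + real m + 1 / 2) m / pochhammer c m"
    by (subst Vandermonde_pochhammer_real[OF c]) (simp add: algebra_simps)
  finally show ?thesis .
qed

text \<open>Brings the Beta moment \<open>(x / 2)_n / (x)_n\<close>, for even \<open>n\<close>, into
  the shape that the Vandermonde sum produces at \<open>c = (x + 1) / 2\<close>.\<close>

lemma pochhammer_half_ratio_even:
  fixes x :: real
  assumes x: "x > 0"
  shows "2 ^ (2 * m) * (pochhammer (x / 2) (2 * m) / pochhammer x (2 * m)) =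
    pochhammer (x / 2 + real m) m / pochhammer ((x + 1) / 2) m"
proof -
  have "pochhammer x (2 * m) = 2 ^ (2 * m) * pochhammer (x / 2) m * pochhammer ((x + 1) / 2) m"
    using pochhammer_double[of "x / 2" m] by (simp add: add_divide_distrib)
  moreover have "pochhammer (x / 2) (2 * m) = pochhammer (x / 2) m * pochhammer (x / 2 + real m) m"
    using pochhammer_product'[of "x / 2" m m] by (simp add: mult_2)
  moreover have "pochhammer (x / 2) m > 0" using x by (simp add: pochhammer_pos)
  ultimately show ?thesis by simp
qed

lemma pochhammer_half_ratio_odd:
  fixes x :: real
  assumes x: "x > 0"
  shows "2 ^ Suc (2 * m) * (pochhammer (x / 2) (Suc (2 * m)) / pochhammer x (Suc (2 * m))) =
    pochhammer (x / 2 + real m + 1) m / pochhammer ((x + 1) / 2) m"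
proof -
  have "pochhammer x (Suc (2 * m)) = 
     (x + 2 * real m) * (2 ^ (2 * m) * pochhammer (x / 2) m * pochhammer ((x + 1) / 2) m)"
    using pochhammer_double[of "x / 2" m] by (simp add: add_divide_distrib pochhammer_rec')
  also have "\<dots> = 2 ^ Suc (2 * m) * pochhammer (x / 2) (Suc m) * pochhammer ((x + 1) / 2) m"
    by (simp add: pochhammer_rec' field_simps)
  finally have "pochhammer x (Suc (2 * m)) =
     2 ^ Suc (2 * m) * pochhammer (x / 2) (Suc m) * pochhammer ((x + 1) / 2) m" .
  moreover have "pochhammer (x / 2) (Suc (2 * m)) = pochhammer (x / 2) (Suc m) * pochhammer (x / 2 + real m + 1) m"
    using pochhammer_product'[of "x / 2" "Suc m" m] by (simp add: mult_2 add_ac)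
  moreover have "pochhammer (x / 2) (Suc m) > 0" using x by (simp add: pochhammer_pos)
  ultimately show ?thesis by simp
qed

text \<open>Behind this is a variable \<open>u\<close> on \<open>[-1, 1]\<close> with density
  proportional to \<open>(1 - u^2)^(x/2 - 1)\<close>: the left side expands the mean of
  \<open>(1 - u) ^ n\<close> into even moments, while \<open>(1 - u) / 2\<close> has the Beta
  distribution with both parameters \<open>x / 2\<close>.\<close>

lemma sum_binomial_even_moments:
  fixes x :: real
  assumes x: "x > 0"
  shows "(\<Sum>j\<le>n div 2. real (n choose (2 * j)) * (pochhammer (1 / 2) j / pochhammer ((x + 1) / 2) j)) =
    2 ^ n * (pochhammer (x / 2) n / pochhammer x n)"
proof (cases "even n")
  case True
  then obtain m where n: "n = 2 * m" by auto
  have shift: "(x + 1) / 2 + real m - 1 / 2 = x / 2 + real m" by (simp add: field_simps)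
  show ?thesis
    using sum_binomial_even[of "(x + 1) / 2" m, unfolded shift] pochhammer_half_ratio_even[OF x, of m] x by (simp add: n)
next
  case False
  then obtain m where n: "n = Suc (2 * m)" by (auto elim!: oddE)
  have shift: "(x + 1) / 2 + real m + 1 / 2 = x / 2 + real m + 1" by (simp add: field_simps)
  show ?thesis
    using sum_binomial_odd[of "(x + 1) / 2" m, unfolded shift] pochhammer_half_ratio_odd[OF x, of m] x
    by (simp add: n del: binomial_Suc_Suc power_Suc)
qed

text \<open>The coefficient of \<open>w ^ n\<close> in the polynomial part, with
  \<open>N = M - 1\<close> and with the dimension \<open>d\<close> as the real \<open>x\<close>. The
  prefactor of the \<open>3F2\<close> is absorbed and the negative parameters are reversed. The
  moment computation, the \<open>3F2\<close> and the Cauchy product behind the \<open>4F3\<close>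
  all meet in this form.\<close>

definition Q_coeff :: "real \<Rightarrow> nat \<Rightarrow> nat \<Rightarrow> real" where
  "Q_coeff x N n = (-1) ^ n * fact n * (real (N choose n))\<^sup>2 *
     pochhammer (x / 2 + 1 + real N) (N - n) / ((2 * real (N - n) + 1) * pochhammer ((x + 1) / 2) N)"

lemma pochhammer_minus_of_nat:
  "pochhammer (- real N) n = (-1) ^ n * fact n * real (N choose n)"
  by (simp add: binomial_gbinomial gbinomial_pochhammer flip: mult.assoc power_mult_distrib)

lemma Q_kernel_expand:
  assumes d: "d > 0"
  shows "Q_kernel d (Suc N) x y = (\<Sum>n\<le>N. Q_coeff (real d) N n * ((1 - x \<bullet> y) / 2) ^ n)"
proof -
  define D where "D = real d"
  have D: "D > 0" using d by (simp add: D_def)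
  define P where "P = 2 ^ Suc (2 * N) / (2 * real N + 1) * (pochhammer (D / 2) (Suc (2 * N)) / pochhammer D (Suc (2 * N)))"
  have P: "P = pochhammer (D / 2 + real N + 1) N / pochhammer ((D + 1) / 2) N / (2 * real N + 1)"
  proof -
    have "P = 2 ^ Suc (2 * N) * (pochhammer (D / 2) (Suc (2 * N)) / pochhammer D (Suc (2 * N))) / (2 * real N + 1)"
      by (simp add: P_def del: power_Suc)
    also note pochhammer_half_ratio_odd[OF D, of N]
    finally show ?thesis .
  qed
  have trm: "P * (pochhammer (- real N) n * (pochhammer (- 1 / 2 - real N) n * pochhammer (- real N) n) /
       (pochhammer (1 / 2 - real N) n * pochhammer (- D / 2 - 2 * real N) n) / fact n) = Q_coeff D N n"
    if n: "n \<le> N" for n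
  proof -
    \<comment> \<open>The parameters \<open>1/2 - M\<close> and \<open>3/2 - M\<close> differ by
      one, so the quotient of their Pochhammer symbols collapses to \<open>a / (a + n)\<close> with
      \<open>a = - 1/2 - N\<close>.\<close>
    have "(- 1 / 2 - real N) * pochhammer (1 / 2 - real N) n =
        pochhammer (- 1 / 2 - real N) n * (- 1 / 2 - real N + real n)"
      using pochhammer_rec[of "- 1 / 2 - real N" n] pochhammer_rec'[of "- 1 / 2 - real N" n] by (simp add: algebra_simps)
    moreover have "2 * real (N - n) + 1 > 0" by (simp add: add_nonneg_pos)
    moreover have "pochhammer (1 / 2 - real N) n \<noteq> 0"
    proof
      assume "pochhammer (1 / 2 - real N) n = 0"
      then obtain k where "1 / 2 - real N = - real k" by (auto simp: pochhammer_eq_0_iff)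
      then have "real (1 + 2 * k) = real (2 * N)" by (simp add: field_simps)
      then have "1 + 2 * k = 2 * N" by (simp only: of_nat_eq_iff)
      then show False by presburger
    qed
    ultimately have r1: "pochhammer (- 1 / 2 - real N) n / pochhammer (1 / 2 - real N) n =
        (2 * real N + 1) / (2 * real (N - n) + 1)"
      using n by (simp add: divide_simps of_nat_diff) (simp add: algebra_simps)
    \<comment> \<open>Reversing this lower parameter gives exactly the last \<open>n\<close> factors
      of the numerator of \<open>P\<close>; after cancellation the first \<open>N - n\<close>
      remain.\<close>
    have r2: "pochhammer (- D / 2 - 2 * real N) n = (-1) ^ n * pochhammer (D / 2 + real N + 1 + real (N - n)) n"
      using pochhammer_minus[of "D / 2 + 2 * real N" n] n by (simp add: of_nat_diff algebra_simps)
    have r3: "pochhammer (D / 2 + real N + 1) N =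
        pochhammer (D / 2 + real N + 1) (N - n) * pochhammer (D / 2 + real N + 1 + real (N - n)) n"
      using pochhammer_product[of "N - n" N "D / 2 + real N + 1"] n by simp
    have nz: "pochhammer (D / 2 + real N + 1 + real (N - n)) n > 0"
      using D by (intro pochhammer_pos) simp
    have "P * (pochhammer (- real N) n * (pochhammer (- 1 / 2 - real N) n * pochhammer (- real N) n) /
       (pochhammer (1 / 2 - real N) n * pochhammer (- D / 2 - 2 * real N) n) / fact n) =
      P * (pochhammer (- real N) n)\<^sup>2 * (pochhammer (- 1 / 2 - real N) n / pochhammer (1 / 2 - real N) n)
         / pochhammer (- D / 2 - 2 * real N) n / fact n"
      by (simp add: power2_eq_square)
    also have "\<dots> = Q_coeff D N n"
      unfolding r1 r2 P r3 Q_coeff_def pochhammer_minus_of_nat using nz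
      by (simp add: power_mult_distrib power2_eq_square add_ac mult_ac power_minus_mult divide_simps) 
    finally show ?thesis .
  qed
  have "Q_kernel d (Suc N) x y = P * hypergeometric [- real N, - 1 / 2 - real N, - real N]
       [1 / 2 - real N, - D / 2 - 2 * real N] ((1 - x \<bullet> y) / 2)"
  proof -
    have [simp]: "1 / 2 - real (Suc N) = - 1 / 2 - real N" "3 / 2 - real (Suc N) = 1 / 2 - real N"
      "2 - real d / 2 - 2 * real (Suc N) = - D / 2 - 2 * real N" "1 - real (Suc N) = - real N"
      "2 * Suc N - 1 = Suc (2 * N)"  "2 * real (Suc N) - 1 = 2 * real N + 1"
      by (simp_all add: field_simps D_def)
    show ?thesis unfolding Q_kernel_def P_def by (simp only: \<open>2 * Suc N - 1 = Suc (2 * N)\<close>) (simp add: D_def del: of_nat_Suc power_Suc)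
  qed
  also have "hypergeometric [- real N, - 1 / 2 - real N, - real N]
       [1 / 2 - real N, - D / 2 - 2 * real N] ((1 - x \<bullet> y) / 2) =
     (\<Sum>n\<le>N. (pochhammer (- real N) n * (pochhammer (- 1 / 2 - real N) n * pochhammer (- real N) n) /
       (pochhammer (1 / 2 - real N) n * pochhammer (- D / 2 - 2 * real N) n)) * ((1 - x \<bullet> y) / 2) ^ n / fact n)"
    by (subst hypergeometric_terminating[of N]) simp_all
  also have "P * \<dots> = (\<Sum>n\<le>N. Q_coeff D N n * ((1 - x \<bullet> y) / 2) ^ n)"
    unfolding sum_distrib_left
  proof (rule sum.cong[OF refl])
    fix n assume "n \<in> {..N}"
    then show "P * (pochhammer (- real N) n * (pochhammer (- 1 / 2 - real N) n * pochhammer (- real N) n) /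
       (pochhammer (1 / 2 - real N) n * pochhammer (- D / 2 - 2 * real N) n) * ((1 - x \<bullet> y) / 2) ^ n / fact n) =
       Q_coeff D N n * ((1 - x \<bullet> y) / 2) ^ n"
      by (subst trm[symmetric]) simp_all
  qed
  finally show ?thesis by (simp add: D_def)
qed

text \<open>Up to a constant, term \<open>n\<close> on the left is coefficient \<open>n\<close> of
  \<open>2F1(-N, x/2; x)\<close> times coefficient \<open>N - n\<close> of
  \<open>2F1(1/2, x/2 + 1 + N; 3/2)\<close>. Euler's transformation turns the factors into
  \<open>2F1(N + x, x/2; x)\<close> and \<open>2F1(1, (1 - x)/2 - N; 3/2)\<close>; the exponents of
  \<open>1 - X\<close> are \<open>N + x/2\<close> and its negative up to order, so they
  cancel.\<close>

lemma sum_Q_coeff_pochhammer: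
  fixes x :: real
  assumes x: "x > 0"
  shows "(\<Sum>n\<le>N. Q_coeff x N n * (pochhammer (x / 2) n / pochhammer x n)) =
    (-1) ^ N * (fact N / pochhammer (3 / 2) N) *
    (\<Sum>n\<le>N. pochhammer (- 1 / 2 - real N) n * pochhammer (real N + x) n * pochhammer (x / 2) n /
       (pochhammer ((x + 1) / 2) n * pochhammer x n * fact n))"
proof -
  let ?H = "\<lambda>a b c. fps_hypergeo [a, b] [c] (1::real)"
  have "?H (real N + x) (x / 2) x * ?H 1 ((1 - x) / 2 - real N) (3 / 2) =
      ?H (x - (real N + x)) (x - x / 2) x * ?H (3 / 2 - 1) (3 / 2 - ((1 - x) / 2 - real N)) (3 / 2)"
  proof (rule fps_hypergeo_Euler_product)
    show "x + of_nat n \<noteq> 0" "3 / 2 + of_nat n \<noteq> (0::real)" for n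
      using x by (auto simp: add_eq_0_iff_both_eq_0 add_nonneg_eq_0_iff add_pos_nonneg less_imp_neq[symmetric])
    show "real N + x + x / 2 - x = - (1 + ((1 - x) / 2 - real N) - 3 / 2)"
      by (simp add: field_simps)
  qed
  also have "x - (real N + x) = - real N" by simp
  also have "x - x / 2 = x / 2" by (simp add: field_simps)
  also have "3 / 2 - 1 = (1 / 2 :: real)" by simp
  also have "3 / 2 - ((1 - x) / 2 - real N) = x / 2 + 1 + real N" by (simp add: field_simps)
  finally have euler: "?H (- real N) (x / 2) x * ?H (1 / 2) (x / 2 + 1 + real N) (3 / 2) =
      ?H (real N + x) (x / 2) x * ?H 1 ((1 - x) / 2 - real N) (3 / 2)" ..
  have left: "Q_coeff x N n * (pochhammer (x / 2) n / pochhammer x n) =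
      fact N / pochhammer ((x + 1) / 2) N * (fps_nth (?H (- real N) (x / 2) x) n *
        fps_nth (?H (1 / 2) (x / 2 + 1 + real N) (3 / 2)) (N - n))" if n: "n \<le> N" for n
  proof -
    have "(1 / 2) * pochhammer (3 / 2) (N - n) = pochhammer (1 / 2) (N - n) * (1 / 2 + real (N - n))"
      using pochhammer_rec[of "1 / 2 :: real" "N - n"] pochhammer_rec'[of "1 / 2 :: real" "N - n"] by (simp add: mult_ac)
    moreover have "pochhammer (3 / 2 :: real) (N - n) > 0" "pochhammer (1 / 2 :: real) (N - n) > 0"
      by (simp_all add: pochhammer_pos)
    moreover have "2 * real (N - n) + 1 > 0" by (simp add: add_nonneg_pos)
    ultimately have r1: "pochhammer (1 / 2 :: real) (N - n) / pochhammer (3 / 2) (N - n) = 1 / (2 * real (N - n) + 1)"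
      by (simp add: divide_simps)
    have r2: "fact N = (fact n * fact (N - n) * real (N choose n) :: real)"
      using binomial_fact_lemma[OF n] by (metis of_nat_fact of_nat_mult)
    have "fact N / pochhammer ((x + 1) / 2) N * (fps_nth (?H (- real N) (x / 2) x) n *
        fps_nth (?H (1 / 2) (x / 2 + 1 + real N) (3 / 2)) (N - n)) =
      fact N / pochhammer ((x + 1) / 2) N * pochhammer (- real N) n * (pochhammer (x / 2) n / pochhammer x n) / fact n *
        (pochhammer (1 / 2) (N - n) / pochhammer (3 / 2) (N - n)) * pochhammer (x / 2 + 1 + real N) (N - n) / fact (N - n)"
      by simp
    also have "\<dots> = Q_coeff x N n * (pochhammer (x / 2) n / pochhammer x n)"
      unfolding r1 r2 Q_coeff_def pochhammer_minus_of_nat by (simp add: power2_eq_square mult_ac)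
    finally show ?thesis ..
  qed
  have right: "fact N / pochhammer ((x + 1) / 2) N * (fps_nth (?H (real N + x) (x / 2) x) n *
        fps_nth (?H 1 ((1 - x) / 2 - real N) (3 / 2)) (N - n)) =
      (-1) ^ N * (fact N / pochhammer (3 / 2) N) *
      (pochhammer (- 1 / 2 - real N) n * pochhammer (real N + x) n * pochhammer (x / 2) n /
         (pochhammer ((x + 1) / 2) n * pochhammer x n * fact n))" if n: "n \<le> N" for n
  proof -
    have pos: "pochhammer ((x + 1) / 2) n > 0" "pochhammer (3 / 2 :: real) N > 0"
      "pochhammer (3 / 2 :: real) (N - n) > 0" "pochhammer (3 / 2 + real (N - n)) n > 0"
      using x by (auto intro!: pochhammer_pos)
    \<comment> \<open>Reversal leaves the last \<open>N - n\<close> factors of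
      \<open>((x + 1) / 2)_N\<close>; against the prefactor only \<open>((x + 1) / 2)_n\<close>
      survives, a lower parameter of the \<open>4F3\<close>.\<close>
    have "(1 - x) / 2 - real N = - ((x - 1) / 2 + real N)"
      "(x - 1) / 2 + real N - real (N - n) + 1 = (x + 1) / 2 + real n"
      using n by (simp_all add: of_nat_diff field_simps)
    then have "pochhammer ((1 - x) / 2 - real N) (N - n) = (-1) ^ (N - n) * pochhammer ((x + 1) / 2 + real n) (N - n)"
      by (simp only: pochhammer_minus)
    moreover have p1: "pochhammer ((x + 1) / 2) N = pochhammer ((x + 1) / 2) n * pochhammer ((x + 1) / 2 + real n) (N - n)"
      using pochhammer_product[OF n, of "(x + 1) / 2"] by simp
    ultimately have r1: "pochhammer ((1 - x) / 2 - real N) (N - n) =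
        (-1) ^ (N - n) * (pochhammer ((x + 1) / 2) N / pochhammer ((x + 1) / 2) n)"
      using pos by simp
    have "- 1 / 2 - real N = - (1 / 2 + real N)" "1 / 2 + real N - real n + 1 = 3 / 2 + real (N - n)"
      using n by (simp_all add: of_nat_diff)
    then have "pochhammer (- 1 / 2 - real N) n = (-1) ^ n * pochhammer (3 / 2 + real (N - n)) n"
      by (simp only: pochhammer_minus)
    moreover have "pochhammer (3 / 2 :: real) N = pochhammer (3 / 2) (N - n) * pochhammer (3 / 2 + real (N - n)) n"
      using pochhammer_product[of "N - n" N "3 / 2 :: real"] n by simp
    ultimately have r2: "1 / pochhammer (3 / 2) (N - n) = (-1) ^ n * pochhammer (- 1 / 2 - real N) n / pochhammer (3 / 2) N"
      using pos by (simp add: power_mult_distrib flip: power_add mult.assoc)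
    \<comment> \<open>The two reversals contribute signs that depend on \<open>n\<close>, but their
      product does not.\<close>
    have sgn: "(-1) ^ (N - n) * (-1) ^ n = ((-1) ^ N :: real)"
      using n by (simp flip: power_add)
    have "pochhammer ((x + 1) / 2) N > 0" using x by (intro pochhammer_pos) simp
    then have "fact N / pochhammer ((x + 1) / 2) N * (fps_nth (?H (real N + x) (x / 2) x) n *
        fps_nth (?H 1 ((1 - x) / 2 - real N) (3 / 2)) (N - n)) =
       fact N * ((-1) ^ (N - n) * (-1) ^ n) * (pochhammer (real N + x) n * pochhammer (x / 2) n /
          (pochhammer x n * fact n)) / pochhammer ((x + 1) / 2) n * (pochhammer (- 1 / 2 - real N) n / pochhammer (3 / 2) N)"
      using arg_cong[OF r2, of "\<lambda>u. u * (fact N * (pochhammer (real N + x) n * pochhammer (x / 2) n /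
          (pochhammer x n * fact n)) * (-1) ^ (N - n) / pochhammer ((x + 1) / 2) n)"]
      by (simp add: r1 mult_ac flip: pochhammer_fact)
    then show ?thesis unfolding sgn by (simp add: mult_ac)
  qed
  have "(\<Sum>n\<le>N. Q_coeff x N n * (pochhammer (x / 2) n / pochhammer x n)) =
     fact N / pochhammer ((x + 1) / 2) N *
      fps_nth (?H (- real N) (x / 2) x * ?H (1 / 2) (x / 2 + 1 + real N) (3 / 2)) N"
    unfolding fps_mult_nth atLeast0AtMost sum_distrib_left by (intro sum.cong refl left) auto
  also have "\<dots> = (-1) ^ N * (fact N / pochhammer (3 / 2) N) *
    (\<Sum>n\<le>N. pochhammer (- 1 / 2 - real N) n * pochhammer (real N + x) n * pochhammer (x / 2) n /
       (pochhammer ((x + 1) / 2) n * pochhammer x n * fact n))"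
    unfolding euler fps_mult_nth atLeast0AtMost sum_distrib_left by (intro sum.cong refl right) auto
  finally show ?thesis .
qed

section \<open>Closed form on the two-sphere\<close>

text \<open>The partial sums telescope: for \<open>c = a + b + 1\<close> one has
  \<open>(c + m) * (1 + m) + a * b = (a + 1 + m) * (b + 1 + m)\<close>.\<close>

lemma sum_pochhammer_balanced:
  fixes a b c :: "'a::field_char_0"
  assumes c: "c = a + b + 1" "\<And>n. c + of_nat n \<noteq> 0"
  shows "(\<Sum>k\<le>m. pochhammer a k * pochhammer b k / (pochhammer c k * fact k)) =
    pochhammer (a + 1) m * pochhammer (b + 1) m / (pochhammer c m * fact m)"
proof (induction m)
  case (Suc m)
  have nz: "pochhammer c m \<noteq> 0" "c + of_nat m \<noteq> 0" "(1 + of_nat m :: 'a) \<noteq> 0"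
    using c(2) by (auto simp: pochhammer_eq_0_iff eq_neg_iff_add_eq_0) (metis of_nat_Suc of_nat_neq_0)
  let ?p = "pochhammer (a + 1) m * pochhammer (b + 1) m / (pochhammer c m * fact m)"
  have "(\<Sum>k\<le>Suc m. pochhammer a k * pochhammer b k / (pochhammer c k * fact k)) =
      ?p + pochhammer a (Suc m) * pochhammer b (Suc m) / (pochhammer c (Suc m) * fact (Suc m))"
    by (simp add: Suc)
  also have "pochhammer a (Suc m) * pochhammer b (Suc m) / (pochhammer c (Suc m) * fact (Suc m)) =
      ?p * (a * b / ((c + of_nat m) * (1 + of_nat m)))"
    unfolding pochhammer_rec[of a] pochhammer_rec[of b] pochhammer_rec'[of c] fact_Suc by (simp add: mult_ac)
  also have "?p + \<dots> = ?p * (1 + a * b / ((c + of_nat m) * (1 + of_nat m)))"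
    by (simp only: distrib_left mult_1_right)
  also have "1 + a * b / ((c + of_nat m) * (1 + of_nat m)) =
      (a + 1 + of_nat m) * (b + 1 + of_nat m) / ((c + of_nat m) * (1 + of_nat m))"
    using nz by (simp add: c(1) divide_simps) (simp add: algebra_simps)
  also have "?p * \<dots> = pochhammer (a + 1) (Suc m) * pochhammer (b + 1) (Suc m) / (pochhammer c (Suc m) * fact (Suc m))"
    unfolding pochhammer_rec' fact_Suc by (simp add: mult_ac)
  finally show ?case .
qed simp

text \<open>At \<open>d = 2\<close> the values \<open>(1)_n = n!\<close>,
  \<open>(2)_n = (n + 1)!\<close> and \<open>(3/2)_n = 2 (1/2)_(n+1)\<close> make term
  \<open>n\<close> the term \<open>n + 1\<close> of a \<open>2F1\<close> with lower parameter
  \<open>1/2\<close>, divided by \<open>2 * (a * b)\<close>. Since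
  \<open>a * b = - (2 * M + 1) * M / 2\<close>, the result has one factor \<open>2 * M + 1\<close>
  in its denominator where the bracket has two; the remaining 2 stems from
  \<open>(3/2)_N = 2 (1/2)_M\<close>. Hence the factor in front of the bracket.\<close>

lemma sum_pochhammer_two_sphere:
  fixes N :: nat
  defines "M \<equiv> Suc N"
  shows "(-1) ^ N * (fact N / pochhammer (3 / 2) N) *
    (\<Sum>n\<le>N. pochhammer (- 1 / 2 - real N) n * pochhammer (real N + 2) n * pochhammer (2 / 2) n /
       (pochhammer ((2 + 1) / 2) n * pochhammer 2 n * fact n)) =
    (2 * real M + 1) / 2 *
         (2 ^ (2 * M) / ((real M)\<^sup>2 * (2 * real M + 1)\<^sup>2) +
          (-1) ^ (M - 1) / (real M * (2 * real M + 1)\<^sup>2) *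
            (fact (M - 1) / pochhammer (1 / 2) M))"
proof -
  define a b :: real where "a = - 3 / 2 - real N" and "b = real M"
  define h :: real where "h = pochhammer (1 / 2) M"
  have h: "h > 0" by (simp add: h_def pochhammer_pos)
  have ab: "a * b = - (2 * real M + 1) * real M / 2"
    by (simp add: a_def b_def M_def field_simps)
  have ab0: "a * b \<noteq> 0" unfolding ab by (simp add: M_def)
  let ?f = "\<lambda>k. pochhammer a k * pochhammer b k / (pochhammer (1 / 2) k * fact k)"
  have trm: "pochhammer (- 1 / 2 - real N) n * pochhammer (real N + 2) n * pochhammer (2 / 2) n /
       (pochhammer ((2 + 1) / 2) n * pochhammer 2 n * fact n) = ?f (Suc n) / (2 * (a * b))" for n
  proof -
    have a: "pochhammer a (Suc n) = a * pochhammer (- 1 / 2 - real N) n"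
      by (subst pochhammer_rec) (simp add: a_def field_simps)
    have b: "pochhammer b (Suc n) = b * pochhammer (real N + 2) n"
      by (subst pochhammer_rec) (simp add: b_def M_def field_simps)
    have c: "pochhammer (1 / 2 :: real) (Suc n) = 1 / 2 * pochhammer ((2 + 1) / 2) n"
      by (subst pochhammer_rec) simp
    have e: "fact (Suc n) = (pochhammer 2 n :: real)"
      using pochhammer_rec[of "1 :: real" n] by (simp add: pochhammer_fact)
    have "pochhammer (2 / 2) n = (fact n :: real)" by (simp add: pochhammer_fact)
    moreover have "a \<noteq> 0" "b \<noteq> 0" using ab0 by auto
    ultimately show ?thesis unfolding a b c e by simp
  qed
  have f: "(\<Sum>k\<le>M. ?f k) = (-1) ^ M * (4 ^ M * h / fact M)"
  proof -
    have "(\<Sum>k\<le>M. ?f k) = pochhammer (a + 1) M * pochhammer (b + 1) M / (h * fact M)"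
      unfolding h_def by (rule sum_pochhammer_balanced) (simp_all add: a_def b_def M_def add_pos_nonneg less_imp_neq[symmetric])
    also have "pochhammer (a + 1) M = (-1) ^ M * h"
    proof -
      have "a + 1 = - (1 / 2 + real N)" "1 / 2 + real N - real M + 1 = 1 / 2"
        by (simp_all add: a_def M_def)
      then show ?thesis unfolding h_def by (simp only: pochhammer_minus)
    qed
    also have "pochhammer (b + 1) M = 4 ^ M * h"
    proof -
      have "fact M * pochhammer (b + 1) M = fact (2 * M)"
        using pochhammer_product'[of "1 :: real" M M] by (simp add: pochhammer_fact b_def add_ac mult_2)
      also have "\<dots> = fact M * (4 ^ M * h)" by (simp add: fact_double h_def power_mult)
      finally show ?thesis by simp
    qed
    finally show ?thesis using h by simp
  qed
  \<comment> \<open>The shifted sum misses the term \<open>k = 0\<close>, which is 1; this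
    \<open>- 1\<close> produces the second summand of the closed form.\<close>
  have "(\<Sum>n\<le>N. ?f (Suc n)) = (\<Sum>k\<le>M. ?f k) - 1"
    unfolding M_def by (subst sum.atMost_Suc_shift) simp
  also note f
  finally have "(\<Sum>n\<le>N. pochhammer (- 1 / 2 - real N) n * pochhammer (real N + 2) n * pochhammer (2 / 2) n /
       (pochhammer ((2 + 1) / 2) n * pochhammer 2 n * fact n)) =
     ((-1) ^ M * (4 ^ M * h / fact M) - 1) / (2 * (a * b))"
    unfolding trm sum_divide_distrib[symmetric] by (rule arg_cong)
  moreover have "pochhammer (3 / 2) N = 2 * h"
    using pochhammer_rec[of "1 / 2 :: real" N] by (simp add: h_def M_def)
  moreover have "(-1) ^ N * (fact N / (2 * h)) * (((-1) ^ M * (4 ^ M * h / fact M) - 1) / (2 * (a * b))) =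
    (2 * real M + 1) / 2 * (4 ^ M / ((real M)\<^sup>2 * (2 * real M + 1)\<^sup>2) +
          (-1) ^ N / (real M * (2 * real M + 1)\<^sup>2) * (fact N / h))"
  proof -
    have M: "fact M = real M * fact N" "(-1) ^ M = - ((-1) ^ N :: real)"
      by (simp_all add: M_def)
    have s: "(-1) ^ N * (-1) ^ N = (1::real)" by (simp flip: power_add)
    have pos: "real M > 0" "2 * real M + 1 > 0" by (simp_all add: M_def add_pos_pos)
    define m s where "m = real M" and "s = ((-1) ^ N :: real)"
    have "s * (fact N / (2 * h)) * ((- s * (4 ^ M * h / (m * fact N)) - 1) / (- (2 * m + 1) * m)) =
      (2 * m + 1) / 2 * (4 ^ M / (m\<^sup>2 * (2 * m + 1)\<^sup>2) + s / (m * (2 * m + 1)\<^sup>2) * (fact N / h))"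
    proof -
      define g where "g = (fact N :: real)"
      have "g > 0" "m > 0" "2 * m + 1 > 0" "s * s = 1" using pos s by (simp_all add: m_def s_def g_def)
      have "s * (g / (2 * h)) * ((- s * (4 ^ M * h / (m * g)) - 1) / (- (2 * m + 1) * m)) =
        (s * s) * 4 ^ M / (2 * m\<^sup>2 * (2 * m + 1)) + s * g / (2 * h * m * (2 * m + 1))"
        using h \<open>g > 0\<close> \<open>m > 0\<close> \<open>2 * m + 1 > 0\<close>
        by (simp add: divide_simps power2_eq_square) (simp add: algebra_simps)
      also have "\<dots> = (2 * m + 1) / 2 * (4 ^ M / (m\<^sup>2 * (2 * m + 1)\<^sup>2) + s / (m * (2 * m + 1)\<^sup>2) * (g / h))"
        unfolding \<open>s * s = 1\<close> using h \<open>m > 0\<close> \<open>2 * m + 1 > 0\<close>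
        by (simp add: divide_simps power2_eq_square)
      finally show ?thesis by (simp add: g_def)
    qed
    then show ?thesis unfolding M ab by (simp add: m_def s_def)
  qed
  ultimately show ?thesis by (simp add: h_def M_def power_mult)
qed

section \<open>From mixed moments to the coefficients of the polynomial part\<close>

text \<open>Grouping by the total degree \<open>s\<close> in \<open>a\<close> and \<open>b\<close>
  isolates the power of \<open>t\<close>, which depends on \<open>s\<close> alone.\<close>

lemma diff_power_times_diff_power:
  fixes a b t :: "'a::comm_ring_1"
  shows "((t - a) * (t - b)) ^ N = (\<Sum>s\<le>2 * N. (-1) ^ s * t ^ (2 * N - s) *
    (\<Sum>i\<le>s. of_nat (N choose i) * of_nat (N choose (s - i)) * (a ^ i * b ^ (s - i))))"
proof -
  define g where "g i j = (-1) ^ (i + j) * t ^ (2 * N - (i + j)) *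
    (of_nat (N choose i) * of_nat (N choose j) * (a ^ i * b ^ j))" for i j
  have g0: "g i j = 0" if "N < i \<or> N < j" for i j
    using that by (auto simp: g_def binomial_eq_0)
  have pw: "(t - c) ^ N = (\<Sum>i\<le>N. of_nat (N choose i) * ((-1) ^ i * c ^ i) * t ^ (N - i))" for c
    using binomial_ring[of "- c" t N] by (simp add: power_minus[of c])
  have "((t - a) * (t - b)) ^ N = (\<Sum>i\<le>N. \<Sum>j\<le>N. g i j)"
    unfolding power_mult_distrib pw sum_product
  proof (intro sum.cong refl)
    fix i j assume "i \<in> {..N}" "j \<in> {..N}"
    then have "2 * N - (i + j) = (N - i) + (N - j)" by auto
    then show "of_nat (N choose i) * ((- 1) ^ i * a ^ i) * t ^ (N - i) *
       (of_nat (N choose j) * ((- 1) ^ j * b ^ j) * t ^ (N - j)) = g i j"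
      by (simp add: g_def power_add mult_ac)
  qed
  also have "\<dots> = (\<Sum>(i, j)\<in>{..N} \<times> {..N}. g i j)"
    by (simp add: sum.cartesian_product)
  \<comment> \<open>The square of indices may be enlarged to the triangle because \<open>g\<close>
    vanishes as soon as one index exceeds \<open>N\<close>.\<close>
  also have "\<dots> = (\<Sum>(i, j)\<in>{(i, j). i + j \<le> 2 * N}. g i j)"
  proof (rule sum.mono_neutral_left)
    have "{(i, j). i + j \<le> 2 * N} \<subseteq> {..2 * N} \<times> {..2 * N}" by auto
    then show "finite {(i, j). i + j \<le> 2 * N}" by (rule finite_subset) simp
    show "\<forall>i\<in>{(i, j). i + j \<le> 2 * N} - {..N} \<times> {..N}. (case i of (i, j) \<Rightarrow> g i j) = 0"
      by (clarsimp simp: g0 not_le) (metis g0 not_le)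
  qed auto
  also have "\<dots> = (\<Sum>s\<le>2 * N. \<Sum>i\<le>s. g i (s - i))"
    by (rule sum.triangle_reindex_eq)
  also have "\<dots> = (\<Sum>s\<le>2 * N. (-1) ^ s * t ^ (2 * N - s) *
    (\<Sum>i\<le>s. of_nat (N choose i) * of_nat (N choose (s - i)) * (a ^ i * b ^ (s - i))))"
    by (simp add: g_def sum_distrib_left)
  finally show ?thesis .
qed

text \<open>Holding for all real \<open>\<alpha>\<close>, the hypothesis is an identity of
  polynomials. Expanding its right side in powers of \<open>- 4 * w * \<alpha>\<close> and
  \<open>(\<alpha> + 1)\<^sup>2\<close> gives each coefficient, with \<open>i = n + p\<close>. The
  weight \<open>f\<close> is carried along, so the individual moments need not be solved
  for.\<close>

lemma bivariate_moments_from_power_moments: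
  fixes m :: "nat \<Rightarrow> real" and w \<mu> :: real
  assumes "\<And>\<alpha>. (\<Sum>i\<le>2 * k. real ((2 * k) choose i) * m i * \<alpha> ^ i) = \<mu> * ((\<alpha> + 1)\<^sup>2 - 4 * \<alpha> * w) ^ k"
  shows "(\<Sum>i\<le>2 * k. f i * (real ((2 * k) choose i) * m i)) =
    \<mu> * (\<Sum>n\<le>k. real (k choose n) * (- 4 * w) ^ n *
      (\<Sum>p\<le>2 * (k - n). real ((2 * (k - n)) choose p) * f (n + p)))"
proof -
  define P where "P = (\<Sum>i\<le>2 * k. monom (real ((2 * k) choose i) * m i) i)"
  define R where "R = (\<Sum>n\<le>k. smult (\<mu> * (real (k choose n) * (- 4 * w) ^ n)) (monom 1 n * [:1, 1:] ^ (2 * (k - n))))"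
  have "poly P \<alpha> = poly R \<alpha>" for \<alpha>
  proof -
    have "(\<alpha> + 1)\<^sup>2 - 4 * \<alpha> * w = - 4 * w * \<alpha> + (\<alpha> + 1)\<^sup>2" by simp
    then have "((\<alpha> + 1)\<^sup>2 - 4 * \<alpha> * w) ^ k = (\<Sum>n\<le>k. real (k choose n) * ((- 4 * w) ^ n * \<alpha> ^ n) * (\<alpha> + 1) ^ (2 * (k - n)))"
      by (simp only: binomial_ring power_mult_distrib[of "- 4 * w"] power_mult)
    moreover have "poly P \<alpha> = (\<Sum>i\<le>2 * k. real ((2 * k) choose i) * m i * \<alpha> ^ i)"
      by (simp add: P_def poly_sum poly_monom)
    ultimately show ?thesis unfolding assms
      by (simp add: R_def poly_sum poly_monom sum_distrib_left mult_ac add_ac)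
  qed
  then have PR: "P = R" by (simp add: poly_eq_poly_eq_iff[symmetric] fun_eq_iff)
  have cP: "coeff P i = (if i \<le> 2 * k then real ((2 * k) choose i) * m i else 0)" for i
    by (simp add: P_def coeff_sum)
  have lin: "coeff ([:1, 1:] ^ r) j = real (r choose j)" for r j
  proof (cases "j \<le> r")
    case True
    then show ?thesis by (simp add: coeff_linear_poly_power)
  next
    case False
    have "degree ([:1, 1 :: real:] ^ r) = r" by (simp add: degree_power_eq)
    then show ?thesis using False by (simp add: coeff_eq_0)
  qed
  have cR: "coeff R i = (\<Sum>n\<le>k. \<mu> * (real (k choose n) * (- 4 * w) ^ n) *
      (if n \<le> i then real ((2 * (k - n)) choose (i - n)) else 0))" for i
    unfolding R_def coeff_sum by (intro sum.cong refl) (auto simp: coeff_monom_mult lin)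
  have "(\<Sum>i\<le>2 * k. f i * (real ((2 * k) choose i) * m i)) = (\<Sum>i\<le>2 * k. f i * coeff R i)"
    unfolding PR[symmetric] cP by (intro sum.cong) auto
  also have "\<dots> = (\<Sum>n\<le>k. \<mu> * (real (k choose n) * (- 4 * w) ^ n) *
      (\<Sum>i\<le>2 * k. if n \<le> i then real ((2 * (k - n)) choose (i - n)) * f i else 0))"
    unfolding cR sum_distrib_left by (subst sum.swap) (intro sum.cong refl, auto simp: mult_ac)
  also have "\<dots> = (\<Sum>n\<le>k. \<mu> * (real (k choose n) * (- 4 * w) ^ n) *
      (\<Sum>p\<le>2 * (k - n). real ((2 * (k - n)) choose p) * f (n + p)))"
  proof (rule sum.cong[OF refl])
    fix n assume n: "n \<in> {..k}"
    have "(\<Sum>i\<le>2 * k. if n \<le> i then real ((2 * (k - n)) choose (i - n)) * f i else 0) =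
        (\<Sum>i=n..2 * k - n. real ((2 * (k - n)) choose (i - n)) * f i)"
      using n by (intro sum.mono_neutral_cong_right) (auto simp: binomial_eq_0)
    also have "\<dots> = (\<Sum>p\<le>2 * (k - n). real ((2 * (k - n)) choose p) * f (n + p))"
      using n by (intro sum.reindex_bij_witness[of _ "\<lambda>p. n + p" "\<lambda>i. i - n"]) auto
    finally show "\<mu> * (real (k choose n) * (- 4 * w) ^ n) *
      (\<Sum>i\<le>2 * k. if n \<le> i then real ((2 * (k - n)) choose (i - n)) * f i else 0) =
      \<mu> * (real (k choose n) * (- 4 * w) ^ n) *
      (\<Sum>p\<le>2 * (k - n). real ((2 * (k - n)) choose p) * f (n + p))" by (rule arg_cong)
  qed
  finally show ?thesis by (simp add: sum_distrib_left mult_ac)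
qed

text \<open>Written with factorials, the shifts by \<open>n\<close> cancel against
  \<open>(2 * k) choose (n + p)\<close>, up to a constant. What remains is
  \<open>(L choose p) * (L choose (2 * l - p))\<close> with \<open>L = N - n\<close> and
  \<open>l = k - n\<close>, summed by Vandermonde's convolution.\<close>

lemma sum_binomial_ratio:
  assumes n: "n \<le> k" "n \<le> N" and k: "k \<le> N"
  shows "(\<Sum>p\<le>2 * (k - n). real ((2 * (k - n)) choose p) *
      (real (N choose (n + p)) * real (N choose (2 * k - (n + p))) / real ((2 * k) choose (n + p)))) =
    (fact N / fact (N - n))\<^sup>2 * (fact (2 * (k - n)) / fact (2 * k)) * real ((2 * (N - n)) choose (2 * (k - n)))"
proof -
  define L l where "L = N - n" and "l = k - n"
  have N: "N = n + L" and k: "k = n + l" using n by (simp_all add: L_def l_def)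
  have trm: "real ((2 * l) choose p) *
      (real (N choose (n + p)) * real (N choose (2 * k - (n + p))) / real ((2 * k) choose (n + p))) =
      (fact N / fact L)\<^sup>2 * (fact (2 * l) / fact (2 * k)) * (real (L choose p) * real (L choose (2 * l - p)))"
    if p: "p \<le> 2 * l" for p
  proof -
    define q where "q = 2 * l - p"
    have pq: "2 * l = p + q" using p by (simp add: q_def)
    have kk: "2 * k = (n + p) + (n + q)" using pq by (simp add: k)
    have sh: "real (N choose (n + p)) = fact N / fact L * (real (L choose p) * fact p / fact (n + p))" for p
    proof (cases "p \<le> L")
      case True
      then have "n + p \<le> N" "N - (n + p) = L - p" by (simp_all add: N)
      then show ?thesis using True by (simp add: binomial_fact)
    next
      case False
      then show ?thesis by (simp add: N binomial_eq_0)
    qed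
    have "real ((p + q) choose p) = fact (p + q) / (fact p * fact q)"
      by (simp add: binomial_fact)
    moreover have "real (((n + p) + (n + q)) choose (n + p)) = fact ((n + p) + (n + q)) / (fact (n + p) * fact (n + q))"
      by (subst binomial_fact) simp_all
    moreover have "2 * k - (n + p) = n + q" using kk by simp
    ultimately show ?thesis
      unfolding q_def[symmetric] pq kk by (simp add: sh power2_eq_square mult_ac)
  qed
  have "(\<Sum>p\<le>2 * l. real (L choose p) * real (L choose (2 * l - p))) = real ((2 * L) choose (2 * l))"
    using vandermonde[of L L "2 * l"] by (simp add: mult_2 flip: of_nat_mult of_nat_sum)
  moreover have "(\<Sum>p\<le>2 * l. real ((2 * l) choose p) *
      (real (N choose (n + p)) * real (N choose (2 * k - (n + p))) / real ((2 * k) choose (n + p)))) =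
    (\<Sum>p\<le>2 * l. (fact N / fact L)\<^sup>2 * (fact (2 * l) / fact (2 * k)) * (real (L choose p) * real (L choose (2 * l - p))))"
    by (intro sum.cong refl trm) auto
  ultimately show ?thesis
    unfolding L_def[symmetric] l_def[symmetric] by (simp only: sum_distrib_left[symmetric])
qed

text \<open>With \<open>k = n + l\<close> the terms become those of \<open>sum_binomial_odd\<close>
  for the row \<open>2 * L + 1\<close> and the parameter \<open>c + n\<close>.\<close>

lemma Q_coeff_as_moment_sum:
  assumes x: "x > 0" and n: "n \<le> N"
  shows "(\<Sum>k=n..N. pochhammer (1 / 2) k / pochhammer ((x + 1) / 2) k * (real (k choose n) * (- 4) ^ n *
      ((fact N / fact (N - n))\<^sup>2 * (fact (2 * (k - n)) / fact (2 * k)) * real ((2 * (N - n)) choose (2 * (k - n))))) /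
      (2 * real (N - k) + 1)) = Q_coeff x N n"
proof -
  define L c where "L = N - n" and "c = (x + 1) / 2"
  have N: "N = n + L" using n by (simp add: L_def)
  have c: "c > 0" using x by (simp add: c_def)
  have trm: "pochhammer (1 / 2) (n + l) / pochhammer c (n + l) * (real ((n + l) choose n) * (- 4) ^ n *
      ((fact N / fact L)\<^sup>2 * (fact (2 * l) / fact (2 * (n + l))) * real ((2 * L) choose (2 * l)))) /
      (2 * real (L - l) + 1) =
    (-1) ^ n * (fact N / fact L)\<^sup>2 / (fact n * pochhammer c n * (2 * real L + 1)) *
      (real (Suc (2 * L) choose (2 * l)) * (pochhammer (1 / 2) l / pochhammer (c + real n) l))"
    if l: "l \<le> L" for l
  proof -
    have r1: "real ((n + l) choose n) = fact (n + l) / (fact n * fact l)"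
      by (simp add: binomial_fact)
    have f: "fact (2 * l) = (4 ^ l * pochhammer (1 / 2) l * fact l :: real)" for l
      by (simp add: fact_double power_mult)
    have r2: "pochhammer c (n + l) = pochhammer c n * pochhammer (c + real n) l"
      by (rule pochhammer_product')
    \<comment> \<open>The denominator left by the integration over \<open>t\<close> is absorbed
      here; it moves the binomial coefficient from row \<open>2 * L\<close> to the odd row
      \<open>2 * L + 1\<close>.\<close>
    have r3: "real ((2 * L) choose (2 * l)) / (2 * real (L - l) + 1) = real (Suc (2 * L) choose (2 * l)) / (2 * real L + 1)"
    proof -
      have "Suc (2 * L) * ((2 * L) choose (2 * l)) = (Suc (2 * L) - 2 * l) * (Suc (2 * L) choose (2 * l))"
        using binomial_absorb_comp[of "Suc (2 * L)" "2 * l"] by simp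
      then have e: "real (Suc (2 * L)) * real ((2 * L) choose (2 * l)) = real (Suc (2 * L) - 2 * l) * real (Suc (2 * L) choose (2 * l))"
        by (simp only: of_nat_mult[symmetric])
      have "real (Suc (2 * L) - 2 * l) = 2 * real (L - l) + 1" using l by (simp add: of_nat_diff)
      moreover have "real (Suc (2 * L)) = 2 * real L + 1" by simp
      ultimately have "(2 * real L + 1) * real ((2 * L) choose (2 * l)) = (2 * real (L - l) + 1) * real (Suc (2 * L) choose (2 * l))"
        using e by metis
      moreover have "2 * real (L - l) + 1 \<noteq> 0" "2 * real L + 1 \<noteq> 0" by linarith+
      ultimately show ?thesis by (metis (no_types) frac_eq_eq mult.commute)
    qed
    have r4: "pochhammer (1 / 2 :: real) k \<noteq> 0" for k using pochhammer_pos[of "1 / 2 :: real" k] by simp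
    have r5: "(- 4) ^ n = ((-1) ^ n * 4 ^ n :: real)" by (simp flip: power_mult_distrib)
    have "pochhammer (1 / 2) (n + l) / pochhammer c (n + l) * (real ((n + l) choose n) * (- 4) ^ n *
      ((fact N / fact L)\<^sup>2 * (fact (2 * l) / fact (2 * (n + l))) * real ((2 * L) choose (2 * l)))) /
      (2 * real (L - l) + 1) =
      pochhammer (1 / 2) (n + l) / pochhammer c (n + l) * (real ((n + l) choose n) * (- 4) ^ n *
      ((fact N / fact L)\<^sup>2 * (fact (2 * l) / fact (2 * (n + l))))) * (real ((2 * L) choose (2 * l)) / (2 * real (L - l) + 1))"
      by simp
    also have "\<dots> = (-1) ^ n * (fact N / fact L)\<^sup>2 / (fact n * pochhammer c n * (2 * real L + 1)) *
      (real (Suc (2 * L) choose (2 * l)) * (pochhammer (1 / 2) l / pochhammer (c + real n) l))"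
      unfolding r3 r1 f r2 r5 using r4 by (simp add: power_add mult_ac del: binomial_Suc_Suc)
    finally show ?thesis .
  qed
  have "(\<Sum>k=n..N. pochhammer (1 / 2) k / pochhammer c k * (real (k choose n) * (- 4) ^ n *
      ((fact N / fact L)\<^sup>2 * (fact (2 * (k - n)) / fact (2 * k)) * real ((2 * L) choose (2 * (k - n))))) /
      (2 * real (N - k) + 1)) =
    (\<Sum>l\<le>L. pochhammer (1 / 2) (n + l) / pochhammer c (n + l) * (real ((n + l) choose n) * (- 4) ^ n *
      ((fact N / fact L)\<^sup>2 * (fact (2 * l) / fact (2 * (n + l))) * real ((2 * L) choose (2 * l)))) /
      (2 * real (L - l) + 1))"
    using n by (intro sum.reindex_bij_witness[of _ "\<lambda>l. n + l" "\<lambda>k. k - n"]) (auto simp: N)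
  also have "\<dots> = (-1) ^ n * (fact N / fact L)\<^sup>2 / (fact n * pochhammer c n * (2 * real L + 1)) *
     (\<Sum>l\<le>L. real (Suc (2 * L) choose (2 * l)) * (pochhammer (1 / 2) l / pochhammer (c + real n) l))"
    unfolding sum_distrib_left by (intro sum.cong refl trm) auto
  also have "\<dots> = (-1) ^ n * (fact N / fact L)\<^sup>2 / (fact n * pochhammer c n * (2 * real L + 1)) *
     (pochhammer (c + real n + real L + 1 / 2) L / pochhammer (c + real n) L)"
    using c by (subst sum_binomial_odd) simp_all
  also have "c + real n + real L + 1 / 2 = x / 2 + 1 + real N" by (simp add: c_def N field_simps)
  also have "(-1) ^ n * (fact N / fact L)\<^sup>2 / (fact n * pochhammer c n * (2 * real L + 1)) *
     (pochhammer (x / 2 + 1 + real N) L / pochhammer (c + real n) L) = Q_coeff x N n"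
  proof -
    have "pochhammer c N = pochhammer c n * pochhammer (c + real n) L"
      unfolding N by (rule pochhammer_product')
    moreover have "real (N choose n) = fact N / (fact n * fact L)"
      using n by (simp add: binomial_fact L_def)
    ultimately show ?thesis
      by (simp add: Q_coeff_def L_def[symmetric] c_def[symmetric] power2_eq_square mult_ac)
  qed
  finally show ?thesis by (simp add: L_def c_def)
qed

lemma moment_sum_eq_Q_coeff_sum:
  fixes m :: "nat \<Rightarrow> nat \<Rightarrow> real" and w x :: real
  assumes x: "x > 0"
    and m: "\<And>k \<alpha>. (\<Sum>i\<le>2 * k. real ((2 * k) choose i) * m i (2 * k - i) * \<alpha> ^ i) =
      pochhammer (1 / 2) k / pochhammer ((x + 1) / 2) k * ((\<alpha> + 1)\<^sup>2 - 4 * \<alpha> * w) ^ k"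
  shows "(\<Sum>k\<le>N. (\<Sum>i\<le>2 * k. real (N choose i) * real (N choose (2 * k - i)) * m i (2 * k - i)) /
      (2 * real (N - k) + 1)) = (\<Sum>n\<le>N. Q_coeff x N n * w ^ n)"
proof -
  \<comment> \<open>\<open>A n k\<close> is the part of the coefficient of \<open>w ^ n\<close> that
    comes from total degree \<open>2 * k\<close>; after exchanging the triangular sums its sum over
    \<open>k\<close> is \<open>Q_coeff\<close>.\<close>
  define A where "A n k = pochhammer (1 / 2) k / pochhammer ((x + 1) / 2) k * (real (k choose n) * (- 4) ^ n *
      ((fact N / fact (N - n))\<^sup>2 * (fact (2 * (k - n)) / fact (2 * k)) * real ((2 * (N - n)) choose (2 * (k - n))))) /
      (2 * real (N - k) + 1)" for n k
  have pw: "(- 4 * w) ^ n = (- 4) ^ n * w ^ n" for n by (rule power_mult_distrib)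
  have inner: "(\<Sum>i\<le>2 * k. real (N choose i) * real (N choose (2 * k - i)) * m i (2 * k - i)) /
      (2 * real (N - k) + 1) = (\<Sum>n\<le>k. A n k * w ^ n)" if k: "k \<le> N" for k
  proof -
    have "(\<Sum>i\<le>2 * k. real (N choose i) * real (N choose (2 * k - i)) * m i (2 * k - i)) =
      (\<Sum>i\<le>2 * k. (real (N choose i) * real (N choose (2 * k - i)) / real ((2 * k) choose i)) *
         (real ((2 * k) choose i) * m i (2 * k - i)))"
      by (intro sum.cong) auto
    also have "\<dots> = pochhammer (1 / 2) k / pochhammer ((x + 1) / 2) k * (\<Sum>n\<le>k. real (k choose n) * (- 4 * w) ^ n *
      (\<Sum>p\<le>2 * (k - n). real ((2 * (k - n)) choose p) *
        (real (N choose (n + p)) * real (N choose (2 * k - (n + p))) / real ((2 * k) choose (n + p)))))"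
      by (rule bivariate_moments_from_power_moments[OF m])
    also have "\<dots> = pochhammer (1 / 2) k / pochhammer ((x + 1) / 2) k * (\<Sum>n\<le>k. real (k choose n) * (- 4 * w) ^ n *
       ((fact N / fact (N - n))\<^sup>2 * (fact (2 * (k - n)) / fact (2 * k)) * real ((2 * (N - n)) choose (2 * (k - n)))))"
      using k by (intro arg_cong2[where f = "(*)"] sum.cong refl sum_binomial_ratio) auto
    finally have eq: "(\<Sum>i\<le>2 * k. real (N choose i) * real (N choose (2 * k - i)) * m i (2 * k - i)) = \<dots>" .
    show ?thesis
      unfolding eq sum_distrib_left sum_divide_distrib A_def pw
      by (intro sum.cong refl) (simp add: mult_ac)
  qed
  have "(\<Sum>k\<le>N. (\<Sum>i\<le>2 * k. real (N choose i) * real (N choose (2 * k - i)) * m i (2 * k - i)) /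
      (2 * real (N - k) + 1)) = (\<Sum>k\<le>N. \<Sum>n\<le>k. A n k * w ^ n)"
    by (rule sum.cong[OF refl], rule inner) simp
  also have "\<dots> = (\<Sum>k\<le>N. \<Sum>n\<le>N. if n \<le> k then A n k * w ^ n else 0)"
    by (rule sum.cong[OF refl], rule sum.mono_neutral_cong_left) auto
  also have "\<dots> = (\<Sum>n\<le>N. \<Sum>k\<le>N. if n \<le> k then A n k * w ^ n else 0)"
    by (rule sum.swap)
  also have "\<dots> = (\<Sum>n\<le>N. \<Sum>k=n..N. A n k * w ^ n)"
    by (rule sum.cong[OF refl], rule sum.mono_neutral_cong_right) auto
  also have "\<dots> = (\<Sum>n\<le>N. Q_coeff x N n * w ^ n)"
  proof (rule sum.cong[OF refl])
    fix n assume "n \<in> {..N}"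
    then have "(\<Sum>k=n..N. A n k) = Q_coeff x N n"
      unfolding A_def by (intro Q_coeff_as_moment_sum[OF x]) simp
    then show "(\<Sum>k=n..N. A n k * w ^ n) = Q_coeff x N n * w ^ n"
      by (simp flip: sum_distrib_right)
  qed
  finally show ?thesis .
qed

section \<open>Gaussian integrals and moments of the sphere\<close>

text \<open>The values lie in a general normed field since the application is to complex
  characteristic functions.\<close>

lemma integral_lborel_prod:
  fixes f :: "'a::euclidean_space \<Rightarrow> real \<Rightarrow> 'b::{real_normed_field, banach, second_countable_topology}"
  assumes f: "\<And>b. b \<in> Basis \<Longrightarrow> integrable lborel (f b)"
  shows "(LINT x|lborel. (\<Prod>b\<in>Basis. f b (x \<bullet> b))) = (\<Prod>b\<in>Basis. (LINT x|lborel. f b x))"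
proof -
  interpret product_sigma_finite "\<lambda>_::'a. lborel :: real measure" ..
  have [measurable]: "b \<in> Basis \<Longrightarrow> f b \<in> borel_measurable borel" for b
    using borel_measurable_integrable[OF f] by simp
  have "(LINT x|lborel. (\<Prod>b\<in>Basis. f b (x \<bullet> b))) =
      (LINT g|(\<Pi>\<^sub>M b\<in>Basis. lborel). (\<Prod>b\<in>Basis. f b (g b)))"
    unfolding lborel_def[where 'a = 'a] lborel_eq_real by (subst integral_distr) auto
  also have "\<dots> = (\<Prod>b\<in>Basis. (LINT x|lborel. f b x))"
    by (rule product_integral_prod) (use f in auto)
  finally show ?thesis .
qed

definition gaussian_density :: "'a::euclidean_space \<Rightarrow> real" where
  "gaussian_density x = (\<Prod>b\<in>Basis. std_normal_density (x \<bullet> b))"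

lemma gaussian_density_nonneg: "gaussian_density x \<ge> 0"
  by (simp add: gaussian_density_def prod_nonneg)

lemma borel_measurable_gaussian_density [measurable]: "gaussian_density \<in> borel_measurable borel"
  unfolding gaussian_density_def[abs_def] by measurable

text \<open>The product form factors characteristic functions over the coordinates; this form shows
  that the density is radial, as polar coordinates require.\<close>

lemma gaussian_density_norm:
  "gaussian_density (x :: 'a::euclidean_space) = (1 / sqrt (2 * pi)) ^ DIM('a) * exp (- (norm x)\<^sup>2 / 2)"
  unfolding gaussian_density_def
  by (simp add: std_normal_density_def prod.distrib exp_sum[symmetric] sum_divide_distrib[symmetric]
      sum_negf norm_eq_sqrt_inner euclidean_inner[of x x] power2_eq_square prod_dividef power_one_over abs_of_nonneg sum_nonneg)

text \<open>
  Levy's uniqueness theorem makes the marginal independent of the direction of \<open>p\<close>, so that no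
  change of variables under rotations is needed.
\<close>

lemma distr_gaussian_inner:
  fixes p :: "'a::euclidean_space"
  assumes p: "norm p = 1"
  shows "distr (density lborel gaussian_density) borel (\<lambda>x. p \<bullet> x) = std_normal_distribution"
proof (rule Levy_uniqueness)
  have "emeasure (density lborel (gaussian_density :: 'a \<Rightarrow> real)) UNIV = 
      (\<integral>\<^sup>+x. (\<Prod>b\<in>(Basis :: 'a set). ennreal (std_normal_density (x \<bullet> b))) \<partial>lborel)"
    by (simp add: emeasure_density gaussian_density_def prod_ennreal)
  also have "\<dots> = (\<Prod>b\<in>(Basis :: 'a set). (\<integral>\<^sup>+x. ennreal (std_normal_density x) \<partial>lborel))"
    by (rule nn_integral_lborel_prod) auto
  also have "\<dots> = 1"
    using emeasure_density[of std_normal_density lborel UNIV]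
      prob_space.emeasure_space_1[OF prob_space_normal_density[of 1 0]]
    by (simp)
  finally interpret M: prob_space "density lborel (gaussian_density :: 'a \<Rightarrow> real)"
    by (intro prob_spaceI) simp
  show "real_distribution (distr (density lborel gaussian_density) borel ((\<bullet>) p))"
    by (rule M.real_distribution_distr) simp
  show "real_distribution std_normal_distribution"
    by (rule real_dist_normal_dist)
  have char1: "(LINT u|lborel. std_normal_density u *\<^sub>R iexp (s * u)) = exp (- s\<^sup>2 / 2)" for s :: real
    using fun_cong[OF char_std_normal_distribution, of s]
    by (simp add: char_def integral_density)
  have int1: "integrable lborel (\<lambda>u. std_normal_density u *\<^sub>R iexp (s * u))" for s :: real
  proof (rule Bochner_Integration.integrable_bound)
    show "integrable lborel std_normal_density" by simp
  qed auto
  show "char (distr (density lborel gaussian_density) borel ((\<bullet>) p)) = char std_normal_distribution"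
  proof
    fix t
    have "char (distr (density lborel gaussian_density) borel ((\<bullet>) p)) t =
        (LINT x|lborel. gaussian_density x *\<^sub>R iexp (t * (p \<bullet> x)))"
      by (simp add: char_def integral_distr integral_density gaussian_density_nonneg)
    also have "\<dots> = (LINT x|lborel. (\<Prod>b\<in>Basis. std_normal_density (x \<bullet> b) *\<^sub>R iexp (t * (p \<bullet> b) * (x \<bullet> b))))"
    proof (rule Bochner_Integration.integral_cong[OF refl])
      fix x :: 'a
      have "iexp (t * (p \<bullet> x)) = (\<Prod>b\<in>Basis. iexp (t * (p \<bullet> b) * (x \<bullet> b)))"
        unfolding euclidean_inner[of p x] sum_distrib_left of_real_sum exp_sum[OF finite_Basis]
        by (simp add: mult_ac)
      then show "gaussian_density x *\<^sub>R iexp (t * (p \<bullet> x)) =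
          (\<Prod>b\<in>Basis. std_normal_density (x \<bullet> b) *\<^sub>R iexp (t * (p \<bullet> b) * (x \<bullet> b)))"
        by (simp add: gaussian_density_def scaleR_conv_of_real prod.distrib)
    qed
    also have "\<dots> = (\<Prod>b\<in>Basis. (LINT u|lborel. std_normal_density u *\<^sub>R iexp (t * (p \<bullet> b) * u)))"
      by (rule integral_lborel_prod) (rule int1)
    also have "\<dots> = (\<Prod>b\<in>(Basis :: 'a set). complex_of_real (exp (- (t * (p \<bullet> b))\<^sup>2 / 2)))"
      unfolding char1 ..
    also have "\<dots> = complex_of_real (exp (\<Sum>b\<in>(Basis :: 'a set). - (t * (p \<bullet> b))\<^sup>2 / 2))"
      by (simp only: of_real_prod exp_sum[OF finite_Basis])
    also have "(\<Sum>b\<in>(Basis :: 'a set). - (t * (p \<bullet> b))\<^sup>2 / 2) = - t\<^sup>2 / 2 * (p \<bullet> p)"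
      unfolding euclidean_inner[of p p] sum_distrib_left
      by (intro sum.cong) (auto simp: power2_eq_square)
    also have "p \<bullet> p = 1" using p by (simp add: dot_square_norm)
    finally show "char (distr (density lborel gaussian_density) borel ((\<bullet>) p)) t = char std_normal_distribution t"
      by (simp add: char_std_normal_distribution)
  qed
qed

lemma Gamma_plus_of_nat_pos:
  fixes z :: real
  assumes "z > 0"
  shows "Gamma (z + real n) = pochhammer z n * Gamma z"
proof -
  have "z \<notin> \<int>\<^sub>\<le>\<^sub>0" using assms nonpos_Ints_nonpos[of z] by auto
  then show ?thesis
    using pochhammer_Gamma[of z n] Gamma_real_pos[OF assms] by simp
qed

text \<open>The Gamma function unifies the even moments and the odd absolute moments, so the
  quotients of moments below need no parity distinction.\<close>

lemma nn_integral_std_normal_abs_moment: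
  "(\<integral>\<^sup>+u. ennreal (std_normal_density u * \<bar>u\<bar> ^ k) \<partial>lborel) =
    ennreal (2 powr (real k / 2) * Gamma ((real k + 1) / 2) / sqrt pi)"
proof -
  have "has_bochner_integral lborel (\<lambda>u. std_normal_density u * \<bar>u\<bar> ^ k)
      (2 powr (real k / 2) * Gamma ((real k + 1) / 2) / sqrt pi)"
  proof (cases "even k")
    case True
    then obtain j where k: "k = 2 * j" by auto
    have "Gamma (1 / 2 + real j) = pochhammer (1 / 2) j * sqrt pi"
      by (simp add: Gamma_plus_of_nat_pos Gamma_one_half_real)
    moreover have "fact (2 * j) / (2 ^ j * fact j) = (2 ^ j * pochhammer (1 / 2) j :: real)"
    proof -
      have "fact (2 * j) = (2 ^ j * (2 ^ j * pochhammer (1 / 2) j) * fact j :: real)"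
        by (simp add: fact_double power_mult power_mult_distrib[symmetric] flip: mult.assoc)
      then show ?thesis by simp
    qed
    ultimately show ?thesis
      using std_normal_moment_even[of j] by (simp add: k powr_realpow add.commute add_divide_distrib power_even_abs)
  next
    case False
    then obtain j where k: "k = 2 * j + 1" by (auto elim: oddE)
    have "2 powr (real k / 2) = 2 ^ j * sqrt 2"
      by (simp add: k powr_realpow powr_add add_divide_distrib powr_half_sqrt[symmetric])
    moreover have "Gamma ((real k + 1) / 2) = fact j"
      using Gamma_fact[of j, where 'a = real] by (simp add: k add_divide_distrib add.commute)
    ultimately show ?thesis
      using std_normal_moment_abs_odd[of j] 
      by (simp add: k real_sqrt_divide mult_ac)
  qed
  then show ?thesis
    by (subst nn_integral_eq_integral) (auto simp: has_bochner_integral_iff)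
qed

section \<open>Polar coordinates and absolute moments of the sphere\<close>

lemma nn_integral_lborel_scaleR:
  fixes f :: "'a::euclidean_space \<Rightarrow> ennreal" and c :: real
  assumes [measurable]: "f \<in> borel_measurable borel" and c: "c \<noteq> 0"
  shows "(\<integral>\<^sup>+x. f x \<partial>lborel) = ennreal (\<bar>c\<bar> ^ DIM('a)) * (\<integral>\<^sup>+x. f (c *\<^sub>R x) \<partial>lborel)"
  using c by (subst lborel_affine[of c 0]) (simp_all add: nn_integral_density nn_integral_distr nn_integral_cmult)

lemma nn_integral_sphere_measure:
  fixes g :: "'a::euclidean_space \<Rightarrow> ennreal"
  assumes [measurable]: "g \<in> borel_measurable borel"
  shows "(\<integral>\<^sup>+z. g z \<partial>sphere_measure) =
    (\<integral>\<^sup>+x. g (sgn x) * indicator (ball 0 1) x \<partial>lborel) / emeasure lborel (ball (0::'a) 1)"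
proof -
  let ?U = "distr (uniform_measure lborel (ball 0 1)) borel (sgn :: 'a \<Rightarrow> 'a)"
  have sgn [measurable]: "(sgn :: 'a \<Rightarrow> 'a) \<in> borel_measurable (uniform_measure lborel (ball 0 1))"
    using measurable_sets[OF borel_measurable_sgn[where 'a = 'a]] by (auto simp: measurable_def)
  have [measurable]: "sphere (0::'a) 1 \<in> sets borel" by (simp add: borel_closed)
  have "(\<integral>\<^sup>+z. g z \<partial>sphere_measure) = (\<integral>\<^sup>+z. g z * indicator (sphere 0 1) z \<partial>?U)"
    unfolding sphere_measure_def by (subst nn_integral_restrict_space) auto
  also have "\<dots> = (\<integral>\<^sup>+x. g (sgn x) * indicator (sphere 0 1) (sgn x) \<partial>uniform_measure lborel (ball 0 1))"
    by (subst nn_integral_distr) auto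
  also have "\<dots> = (\<integral>\<^sup>+x. g (sgn x) * indicator (sphere 0 1) (sgn x) * indicator (ball 0 1) x \<partial>lborel) /
      emeasure lborel (ball (0::'a) 1)"
    by (subst nn_integral_uniform_measure) auto
  also have "(\<integral>\<^sup>+x. g (sgn x) * indicator (sphere 0 1) (sgn x) * indicator (ball 0 1) x \<partial>lborel) =
      (\<integral>\<^sup>+x. g (sgn x) * indicator (ball 0 1) x \<partial>lborel)"
  proof (rule nn_integral_cong_AE)
    \<comment> \<open>The origin is the only point whose \<open>sgn\<close>, namely 0, lies off the
      sphere.\<close>
    have "AE x in lborel. x \<noteq> (0::'a)"
      by (rule AE_lborel_singleton)
    then show "AE x in lborel. g (sgn x) * indicator (sphere 0 1) (sgn x) * indicator (ball 0 1) x =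
        g (sgn x) * indicator (ball 0 1) x"
      by eventually_elim (auto simp: norm_sgn split: split_indicator)
  qed
  finally show ?thesis .
qed

lemma emeasure_unit_ball_pos_finite:
  "0 < emeasure lborel (ball (0::'a::euclidean_space) 1)" "emeasure lborel (ball (0::'a) 1) < \<infinity>"
  using unit_ball_vol_pos[of "real DIM('a)"] emeasure_lborel_ball_finite[of "0::'a" 1]
  by (auto simp: emeasure_ball)

text \<open>The image under \<open>norm\<close> of the measure with density \<open>g (sgn x)\<close>
  gives \<open>{..<a}\<close> the mass \<open>a ^ n * A\<close>, by scaling the ball of radius
  \<open>a\<close> to the unit ball; so does the density \<open>A * n * \<rho> ^ (n - 1)\<close>.
  These rays form an intersection-stable generator of the Borel sets, and \<open>fin\<close> makes
  their masses finite, so the two measures coincide.\<close>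

lemma nn_integral_polar:
  fixes g :: "'a::euclidean_space \<Rightarrow> ennreal" and \<phi> :: "real \<Rightarrow> ennreal"
  assumes [measurable]: "g \<in> borel_measurable borel" "\<phi> \<in> borel_measurable borel"
    and fin: "(\<integral>\<^sup>+z. g z \<partial>sphere_measure) < \<infinity>"
  shows "(\<integral>\<^sup>+x. \<phi> (norm x) * g (sgn x) \<partial>lborel) =
    emeasure lborel (ball (0::'a) 1) * (\<integral>\<^sup>+z. g z \<partial>sphere_measure) *
    (\<integral>\<^sup>+\<rho>. ennreal (real DIM('a) * \<rho> ^ (DIM('a) - 1)) * \<phi> \<rho> * indicator {0..} \<rho> \<partial>lborel)"
proof -
  define A where "A = emeasure lborel (ball (0::'a) 1) * (\<integral>\<^sup>+z. g z \<partial>sphere_measure)"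
  define n where "n = DIM('a)"
  have n: "n > 0" by (simp add: n_def)
  have A: "A = (\<integral>\<^sup>+x. g (sgn x) * indicator (ball 0 1) x \<partial>lborel)"
    unfolding A_def nn_integral_sphere_measure[OF assms(1)]
    using emeasure_unit_ball_pos_finite[where 'a = 'a]
    by (simp add: ennreal_times_divide mult.commute[of "emeasure lborel (ball 0 1)"] ennreal_mult_divide_eq)
  have A_fin: "A < \<infinity>"
    unfolding A_def using fin emeasure_unit_ball_pos_finite[where 'a = 'a] by (simp add: ennreal_mult_less_top)
  have [measurable]: "(sgn :: 'a \<Rightarrow> 'a) \<in> borel_measurable borel" by (rule borel_measurable_sgn)
  define \<nu> where "\<nu> = distr (density lborel (\<lambda>x. g (sgn x))) borel norm"
  define \<nu>' where "\<nu>' = density lborel (\<lambda>\<rho>. A * (ennreal (real n * \<rho> ^ (n - 1)) * indicator {0..} \<rho>))"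
  have nu: "emeasure \<nu> {..<a} = (if a \<le> 0 then 0 else ennreal (a ^ n) * A)" for a
  proof -
    have "emeasure \<nu> {..<a} = (\<integral>\<^sup>+x. g (sgn x) * indicator {x. norm x < a} x \<partial>lborel)"
    proof -
      have "norm -` {..<a} = {x::'a. norm x < a}" by auto
      then show ?thesis
        by (simp add: \<nu>_def emeasure_distr emeasure_density)
    qed
    also have "\<dots> = (if a \<le> 0 then 0 else ennreal (a ^ n) * A)"
    proof (cases "a \<le> 0")
      case True
      then have "{x::'a. norm x < a} = {}" by (auto simp: not_less intro: order_trans)
      then show ?thesis using True by simp
    next
      case False
      then have a: "a > 0" by simp
      have "(\<integral>\<^sup>+x. g (sgn x) * indicator {x. norm x < a} x \<partial>lborel) =
          ennreal (a ^ n) * (\<integral>\<^sup>+x. g (sgn (a *\<^sub>R x)) * indicator {x. norm x < a} (a *\<^sub>R x) \<partial>lborel)"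
        unfolding n_def using a by (subst nn_integral_lborel_scaleR[of _ a]) auto
      also have "(\<integral>\<^sup>+x. g (sgn (a *\<^sub>R x)) * indicator {x. norm x < a} (a *\<^sub>R x) \<partial>lborel) = A"
        unfolding A using a
        by (intro nn_integral_cong) (auto simp: sgn_scaleR split: split_indicator)
      finally show ?thesis using False by simp
    qed
    finally show ?thesis .
  qed
  have nu': "emeasure \<nu>' {..<a} = (if a \<le> 0 then 0 else ennreal (a ^ n) * A)" for a
  proof -
    have "emeasure \<nu>' {..<a} = A * (\<integral>\<^sup>+\<rho>. ennreal (real n * \<rho> ^ (n - 1)) * indicator {0..} \<rho> * indicator {..<a} \<rho> \<partial>lborel)"
      by (simp add: \<nu>'_def emeasure_density nn_integral_cmult mult.assoc)
    also have "(\<integral>\<^sup>+\<rho>. ennreal (real n * \<rho> ^ (n - 1)) * indicator {0..} \<rho> * indicator {..<a} \<rho> \<partial>lborel) =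
        (if a \<le> 0 then 0 else ennreal (a ^ n))"
    proof (cases "a \<le> 0")
      case True
      have "(\<integral>\<^sup>+\<rho>. ennreal (real n * \<rho> ^ (n - 1)) * indicator {0..} \<rho> * indicator {..<a} \<rho> \<partial>lborel) =
          (\<integral>\<^sup>+\<rho>. 0 \<partial>(lborel :: real measure))"
        using True by (intro nn_integral_cong) (auto split: split_indicator)
      then show ?thesis using True by simp
    next
      case False
      then have a: "a > 0" by simp
      have "(\<integral>\<^sup>+\<rho>. ennreal (real n * \<rho> ^ (n - 1)) * indicator {0..} \<rho> * indicator {..<a} \<rho> \<partial>lborel) =
          (\<integral>\<^sup>+\<rho>. ennreal (real n * \<rho> ^ (n - 1)) * indicator {0..a} \<rho> \<partial>lborel)"
      proof (rule nn_integral_cong_AE)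
        have "AE \<rho> in lborel. \<rho> \<noteq> a" by (rule AE_lborel_singleton)
        then show "AE \<rho> in lborel. ennreal (real n * \<rho> ^ (n - 1)) * indicator {0..} \<rho> * indicator {..<a} \<rho> =
            ennreal (real n * \<rho> ^ (n - 1)) * indicator {0..a} \<rho>"
          by eventually_elim (auto split: split_indicator)
      qed
      also have "\<dots> = ennreal (a ^ n - 0 ^ n)"
        using a by (intro nn_integral_FTC_Icc) (auto intro!: derivative_eq_intros)
      finally show ?thesis using False n by simp
    qed
    finally show ?thesis by (simp add: mult.commute)
  qed
  have "\<nu> = \<nu>'"
  proof (rule measure_eqI_generator_eq)
    show "Int_stable (range (lessThan :: real \<Rightarrow> _))"
    proof (clarsimp simp: Int_stable_def)
      fix a b :: real
      have "{..<a} \<inter> {..<b} = {..<min a b}" by auto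
      then show "{..<a} \<inter> {..<b} \<in> range lessThan" by blast
    qed
    show "sets \<nu> = sigma_sets UNIV (range lessThan)" "sets \<nu>' = sigma_sets UNIV (range lessThan)"
      by (simp_all add: \<nu>_def \<nu>'_def borel_Iio)
    show "emeasure \<nu> X = emeasure \<nu>' X" if "X \<in> range lessThan" for X
      using that by (auto simp: nu nu')
    show "range (\<lambda>i. {..<real i}) \<subseteq> range lessThan" by auto
    show "(\<Union>i. {..<real i}) = UNIV"
      using reals_Archimedean2 by auto
    show "emeasure \<nu> {..<real i} \<noteq> \<infinity>" for i
      using A_fin by (auto simp: nu ennreal_mult_eq_top_iff)
  qed auto
  then have "(\<integral>\<^sup>+\<rho>. \<phi> \<rho> \<partial>\<nu>) = (\<integral>\<^sup>+\<rho>. \<phi> \<rho> \<partial>\<nu>')" by simp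
  moreover have "(\<integral>\<^sup>+\<rho>. \<phi> \<rho> \<partial>\<nu>) = (\<integral>\<^sup>+x. \<phi> (norm x) * g (sgn x) \<partial>lborel)"
    by (simp add: \<nu>_def nn_integral_distr nn_integral_density mult.commute)
  moreover have "(\<integral>\<^sup>+\<rho>. \<phi> \<rho> \<partial>\<nu>') =
      A * (\<integral>\<^sup>+\<rho>. ennreal (real n * \<rho> ^ (n - 1)) * \<phi> \<rho> * indicator {0..} \<rho> \<partial>lborel)"
    unfolding \<nu>'_def
    by (subst nn_integral_density, simp, simp, subst nn_integral_cmult[symmetric])
       (auto intro!: nn_integral_cong simp: mult_ac)
  ultimately show ?thesis by (simp add: A_def n_def)
qed

lemma nn_integral_std_normal_half_moment:
  "(\<integral>\<^sup>+u. ennreal (std_normal_density u * u ^ k) * indicator {0..} u \<partial>lborel) =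
    ennreal (2 powr (real k / 2) * Gamma ((real k + 1) / 2) / (2 * sqrt pi))"
proof -
  let ?f = "\<lambda>u. ennreal (std_normal_density u * \<bar>u\<bar> ^ k)"
  let ?I = "\<integral>\<^sup>+u. ?f u * indicator {0..} u \<partial>lborel"
  have "(\<integral>\<^sup>+u. ?f u \<partial>lborel) = (\<integral>\<^sup>+u. ?f u * indicator {0..} u + ?f u * indicator {..0} u \<partial>lborel)"
  proof (rule nn_integral_cong_AE)
    have "AE u in lborel. u \<noteq> (0::real)" by (rule AE_lborel_singleton)
    then show "AE u in lborel. ?f u = ?f u * indicator {0..} u + ?f u * indicator {..0} u"
      by eventually_elim (auto split: split_indicator)
  qed
  also have "\<dots> = ?I + (\<integral>\<^sup>+u. ?f u * indicator {..0} u \<partial>lborel)"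
    by (rule nn_integral_add) auto
  also have "(\<integral>\<^sup>+u. ?f u * indicator {..0} u \<partial>lborel) = ?I"
    by (subst nn_integral_real_affine[where c = "-1" and t = 0])
      (auto intro!: nn_integral_cong simp: std_normal_density_def split: split_indicator)
  finally have "2 * ?I = ennreal (2 powr (real k / 2) * Gamma ((real k + 1) / 2) / sqrt pi)"
    by (simp add: nn_integral_std_normal_abs_moment mult_2)
  also have "\<dots> = 2 * ennreal (2 powr (real k / 2) * Gamma ((real k + 1) / 2) / (2 * sqrt pi))"
    by (simp add: ennreal_mult'[symmetric] ennreal_numeral[symmetric] del: ennreal_numeral)
  finally have "?I = ennreal (2 powr (real k / 2) * Gamma ((real k + 1) / 2) / (2 * sqrt pi))"
    by (simp add: ennreal_mult_cancel_left)
  moreover have "(\<integral>\<^sup>+u. ennreal (std_normal_density u * u ^ k) * indicator {0..} u \<partial>lborel) = ?I"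
    by (intro nn_integral_cong) (auto split: split_indicator)
  ultimately show ?thesis by simp
qed

text \<open>The mean of \<open>\<bar>p \<bullet> z\<bar> ^ r\<close> over the unit sphere for a unit
  vector \<open>p\<close>. Here \<open>n\<close> is the dimension of the ambient space, thus
  \<open>d + 1\<close> for the sphere of dimension \<open>d\<close>.\<close>

definition sphere_moment :: "nat \<Rightarrow> nat \<Rightarrow> real" where
  "sphere_moment n r = Gamma ((real r + 1) / 2) * Gamma (real n / 2) / (sqrt pi * Gamma ((real n + real r) / 2))"

text \<open>The Gaussian mean of \<open>\<bar>p \<bullet> x\<bar> ^ r\<close> is computed twice: the
  marginal along \<open>p\<close> gives \<open>m r\<close>, polar coordinates give the mean over the
  sphere times \<open>K * m (n - 1 + r)\<close>.\<close>

lemma nn_integral_sphere_inner_unit: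
  fixes p :: "'a::euclidean_space"
  assumes p: "norm p = 1"
  shows "(\<integral>\<^sup>+z. ennreal (\<bar>p \<bullet> z\<bar> ^ r) \<partial>sphere_measure) = ennreal (sphere_moment DIM('a) r)"
proof -
  interpret S: prob_space "sphere_measure :: 'a measure" by (rule prob_space_sphere_measure)
  define n where "n = DIM('a)"
  have n: "n > 0" by (simp add: n_def)
  define m where "m k = 2 powr (real k / 2) * Gamma ((real k + 1) / 2) / sqrt pi" for k
  have m_pos: "m k > 0" for k by (auto simp: m_def intro!: divide_pos_pos mult_pos_pos Gamma_real_pos)
  \<comment> \<open>Everything independent of \<open>r\<close>: the volume of the ball, the
    normalization of the density, and the half-line factor \<open>1 / 2\<close>.\<close>
  define K where "K = emeasure lborel (ball (0::'a) 1) * ennreal (real n * (1 / sqrt (2 * pi)) ^ n * sqrt (2 * pi) / 2)"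
  have key: "ennreal (m r) = (\<integral>\<^sup>+z. ennreal (\<bar>p \<bullet> z\<bar> ^ r) \<partial>sphere_measure) * (K * ennreal (m (n - 1 + r)))" for r
  proof -
    have le1: "\<bar>p \<bullet> z\<bar> ^ r \<le> 1" if "norm z = 1" for z
      using Cauchy_Schwarz_ineq2[of p z] that p by (simp add: power_le_one)
    have "(\<integral>\<^sup>+z. ennreal (\<bar>p \<bullet> z\<bar> ^ r) \<partial>sphere_measure) \<le> (\<integral>\<^sup>+z. 1 \<partial>(sphere_measure :: 'a measure))"
      by (intro nn_integral_mono) (auto simp: le1)
    then have fin: "(\<integral>\<^sup>+z. ennreal (\<bar>p \<bullet> z\<bar> ^ r) \<partial>sphere_measure) < \<infinity>"
      using S.emeasure_space_1 by (simp add: le_less_trans[OF _ ennreal_one_less_top])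
    have "ennreal (m r) = (\<integral>\<^sup>+u. ennreal (\<bar>u\<bar> ^ r) \<partial>std_normal_distribution)"
      by (subst nn_integral_density)
         (auto simp: nn_integral_std_normal_abs_moment m_def ennreal_mult'[symmetric])
    also have "\<dots> = (\<integral>\<^sup>+x. ennreal (gaussian_density x * \<bar>p \<bullet> x\<bar> ^ r) \<partial>lborel)"
      unfolding distr_gaussian_inner[OF p, symmetric]
      by (simp add: nn_integral_distr nn_integral_density ennreal_mult' gaussian_density_nonneg)
    also have "\<dots> = (\<integral>\<^sup>+x. ennreal ((1 / sqrt (2 * pi)) ^ n * exp (- (norm x)\<^sup>2 / 2) * (norm x) ^ r) * ennreal (\<bar>p \<bullet> sgn x\<bar> ^ r) \<partial>lborel)"
    proof (rule nn_integral_cong)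
      fix x :: 'a
      have "x = norm x *\<^sub>R sgn x" by (cases "x = 0") (simp_all add: sgn_div_norm)
      then have "\<bar>p \<bullet> x\<bar> = norm x * \<bar>p \<bullet> sgn x\<bar>"
        by (metis abs_mult abs_norm_cancel inner_scaleR_right)
      then show "ennreal (gaussian_density x * \<bar>p \<bullet> x\<bar> ^ r) =
          ennreal ((1 / sqrt (2 * pi)) ^ n * exp (- (norm x)\<^sup>2 / 2) * (norm x) ^ r) * ennreal (\<bar>p \<bullet> sgn x\<bar> ^ r)"
        by (simp add: gaussian_density_norm n_def power_mult_distrib ennreal_mult'[symmetric] mult_ac)
    qed
    also have "\<dots> = emeasure lborel (ball (0::'a) 1) * (\<integral>\<^sup>+z. ennreal (\<bar>p \<bullet> z\<bar> ^ r) \<partial>sphere_measure) *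
        (\<integral>\<^sup>+\<rho>. ennreal (real n * \<rho> ^ (n - 1)) *
           ennreal ((1 / sqrt (2 * pi)) ^ n * exp (- \<rho>\<^sup>2 / 2) * \<rho> ^ r) * indicator {0..} \<rho> \<partial>lborel)"
      unfolding n_def by (rule nn_integral_polar[OF _ _ fin]) simp_all
    also have "(\<integral>\<^sup>+\<rho>. ennreal (real n * \<rho> ^ (n - 1)) *
           ennreal ((1 / sqrt (2 * pi)) ^ n * exp (- \<rho>\<^sup>2 / 2) * \<rho> ^ r) * indicator {0..} \<rho> \<partial>lborel) =
        (\<integral>\<^sup>+\<rho>. ennreal (real n * (1 / sqrt (2 * pi)) ^ n * sqrt (2 * pi)) *
           (ennreal (std_normal_density \<rho> * \<rho> ^ (n - 1 + r)) * indicator {0..} \<rho>) \<partial>lborel)"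
      by (intro nn_integral_cong)
        (auto simp: std_normal_density_def power_add ennreal_mult'[symmetric] mult_ac split: split_indicator)
    also have "\<dots> = ennreal (real n * (1 / sqrt (2 * pi)) ^ n * sqrt (2 * pi)) * ennreal (m (n - 1 + r) / 2)"
    proof -
      have "m k / 2 = 2 powr (real k / 2) * Gamma ((real k + 1) / 2) / (2 * sqrt pi)" for k
        by (simp add: m_def)
      then show ?thesis
        by (subst nn_integral_cmult) (simp_all only: nn_integral_std_normal_half_moment, simp)
    qed
    also have "\<dots> = ennreal (real n * (1 / sqrt (2 * pi)) ^ n * sqrt (2 * pi) / 2) * ennreal (m (n - 1 + r))"
      using m_pos[of "n - 1 + r"] by (simp add: ennreal_mult'[symmetric])
    finally show ?thesis by (simp add: K_def mult_ac)
  qed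
  obtain \<kappa> where \<kappa>: "K = ennreal \<kappa>" "\<kappa> \<ge> 0"
    using emeasure_unit_ball_pos_finite(2)[where 'a = 'a]
    by (cases K) (auto simp: K_def ennreal_mult_eq_top_iff)
  \<comment> \<open>At \<open>r = 0\<close> the mean over the sphere is 1, which determines the
    constant without evaluating the volume of the ball.\<close>
  have "ennreal (m 0) = ennreal (\<kappa> * m (n - 1))"
    using key[of 0] m_pos[of "n - 1"] \<kappa> S.emeasure_space_1 by (simp add: ennreal_mult')
  then have \<kappa>_eq: "m 0 = \<kappa> * m (n - 1)"
    using m_pos[of 0] m_pos[of "n - 1"] \<kappa> by (simp add: ennreal_inj)
  have m0: "m 0 = 1" by (simp add: m_def Gamma_one_half_real)
  then have \<kappa>_pos: "\<kappa> * m (n - 1 + r) > 0"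
    using \<kappa>_eq \<kappa> m_pos[of "n - 1 + r"] by (metis less_eq_real_def mult_pos_pos mult_zero_left zero_neq_one)
  let ?J = "\<integral>\<^sup>+z. ennreal (\<bar>p \<bullet> z\<bar> ^ r) \<partial>sphere_measure"
  have "ennreal (m r) = ?J * ennreal (\<kappa> * m (n - 1 + r))"
    using key[of r] \<kappa> m_pos[of "n - 1 + r"] by (simp add: ennreal_mult')
  then have "?J = ennreal (m r) / ennreal (\<kappa> * m (n - 1 + r))"
    using ennreal_mult_divide_eq[of "ennreal (\<kappa> * m (n - 1 + r))" ?J] \<kappa>_pos
    by (simp add: ennreal_eq_0_iff not_le)
  also have "\<dots> = ennreal (m r / (\<kappa> * m (n - 1 + r)))"
    using \<kappa>_pos m_pos[of r] by (simp add: divide_ennreal)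
  also have "m r / (\<kappa> * m (n - 1 + r)) = sphere_moment DIM('a) r"
  proof -
    have "\<kappa> = 1 / m (n - 1)" using \<kappa>_eq m0 m_pos[of "n - 1"] by (simp add: field_simps)
    moreover have "Gamma ((real (n - 1) + 1) / 2) = Gamma (real n / 2)" using n by simp
    moreover have "Gamma ((real (n - 1 + r) + 1) / 2) = Gamma ((real n + real r) / 2)" using n by (simp add: add_ac)
    moreover have "2 powr (real (n - 1 + r) / 2) = 2 powr (real r / 2) * 2 powr (real (n - 1) / 2)"
      by (simp add: powr_add[symmetric] add_divide_distrib add.commute)
    ultimately show ?thesis by (simp add: m_def sphere_moment_def n_def)
  qed
  finally show ?thesis .
qed

section \<open>Integration over the threshold\<close>

lemma has_integral_power_Icc:
  fixes a b c :: real
  assumes "a \<le> b"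
  shows "((\<lambda>t. (t - c) ^ m) has_integral ((b - c) ^ Suc m - (a - c) ^ Suc m) / (real m + 1)) {a..b}"
proof -
  have "((\<lambda>t. (t - c) ^ Suc m / (real m + 1)) has_vector_derivative (t - c) ^ m) (at t within S)" for t S
  proof -
    have "((\<lambda>t. t - c) has_real_derivative 1) (at t within S)"
      by (auto intro!: derivative_eq_intros)
    from DERIV_cdivide[OF DERIV_power[OF this, of "Suc m"], of "real m + 1"] show ?thesis
      by (simp add: has_real_derivative_iff_has_vector_derivative add.commute del: power_Suc)
  qed
  from fundamental_theorem_of_calculus[OF assms this] show ?thesis
    by (simp add: diff_divide_distrib)
qed

text \<open>The Beta integral by parts: \<open>?F\<close> vanishes at both endpoints, so one power
  moves from \<open>b - t\<close> to \<open>t - a\<close>. Hence \<open>m\<close> stays arbitrary in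
  the induction.\<close>

lemma has_integral_power_times_power:
  fixes a b :: real
  assumes ab: "a \<le> b"
  shows "((\<lambda>t. (t - a) ^ m * (b - t) ^ n) has_integral
    (b - a) ^ (m + n + 1) * (fact m * fact n / fact (m + n + 1))) {a..b}"
proof (induction n arbitrary: m)
  case 0
  show ?case
    using has_integral_power_Icc[OF ab, of a m] by (simp add: add.commute)
next
  case (Suc n)
  let ?F = "\<lambda>t. (t - a) ^ Suc m * (b - t) ^ Suc n"
  have "((\<lambda>t. real (Suc m) * ((t - a) ^ m * (b - t) ^ Suc n) - real (Suc n) * ((t - a) ^ Suc m * (b - t) ^ n))
      has_integral ?F b - ?F a) {a..b}"
  proof (rule fundamental_theorem_of_calculus[OF ab])
    fix x
    have "((\<lambda>t. t - a) has_real_derivative 1) (at x within {a..b})"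
      "((\<lambda>t. b - t) has_real_derivative -1) (at x within {a..b})"
      by (auto intro!: derivative_eq_intros)
    from DERIV_mult[OF this(1)[THEN DERIV_power, of "Suc m"] this(2)[THEN DERIV_power, of "Suc n"]]
    show "(?F has_vector_derivative real (Suc m) * ((x - a) ^ m * (b - x) ^ Suc n) -
        real (Suc n) * ((x - a) ^ Suc m * (b - x) ^ n)) (at x within {a..b})"
      by (simp add: has_real_derivative_iff_has_vector_derivative mult_ac del: power_Suc of_nat_Suc)
  qed
  from has_integral_add[OF this has_integral_mult_right[OF Suc.IH[of "Suc m"], of "real (Suc n)"]]
  have "((\<lambda>t. real (Suc m) * ((t - a) ^ m * (b - t) ^ Suc n)) has_integral
      real (Suc n) * ((b - a) ^ (Suc m + n + 1) * (fact (Suc m) * fact n / fact (Suc m + n + 1)))) {a..b}"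
    by (simp del: of_nat_Suc fact_Suc)
  from has_integral_mult_right[OF this, of "1 / real (Suc m)"]
  have "((\<lambda>t. (t - a) ^ m * (b - t) ^ Suc n) has_integral
      1 / real (Suc m) * (real (Suc n) * ((b - a) ^ (Suc m + n + 1) * (fact (Suc m) * fact n / fact (Suc m + n + 1))))) {a..b}"
    by (simp del: of_nat_Suc fact_Suc)
  also have "1 / real (Suc m) * (real (Suc n) * ((b - a) ^ (Suc m + n + 1) * (fact (Suc m) * fact n / fact (Suc m + n + 1)))) =
      (b - a) ^ (m + Suc n + 1) * (fact m * fact (Suc n) / fact (m + Suc n + 1))"
    unfolding fact_Suc[of m] fact_Suc[of n] by (simp del: of_nat_Suc fact_Suc)
  finally show ?case .
qed

lemma LBINT_eq_has_integral:
  fixes f :: "real \<Rightarrow> real"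
  assumes "continuous_on {a..b} f" "(f has_integral I) {a..b}"
  shows "(LINT t|lborel. indicator {a..b} t * f t) = I"
proof -
  have "set_integrable lborel {a..b} f"
    using assms(1) by (rule borel_integrable_atLeastAtMost')
  from set_borel_integral_eq_integral(2)[OF this] show ?thesis
    using assms(2) by (simp add: set_lebesgue_integral_def integral_unique)
qed

text \<open>Between \<open>a\<close> and \<open>b\<close> the two factors have opposite signs,
  whence \<open>(-1) ^ N\<close> times a Beta integral. Its value is a power of the length of the
  gap, and this is what turns into the odd power of the distance.\<close>

lemma integral_power_times_power_between:
  fixes a b :: real
  shows "(LINT t|lborel. indicator {min a b..max a b} t * ((t - a) * (t - b)) ^ N) =
    (-1) ^ N * ((fact N)\<^sup>2 / fact (2 * N + 1)) * \<bar>a - b\<bar> ^ (2 * N + 1)"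
proof -
  have *: "(LINT t|lborel. indicator {min a b..max a b} t * ((t - a) * (t - b)) ^ N) =
    (-1) ^ N * ((fact N)\<^sup>2 / fact (2 * N + 1)) * \<bar>a - b\<bar> ^ (2 * N + 1)" if ab: "a \<le> b" for a b :: real
  proof -
    have "((t - a) * (t - b)) ^ N = (-1) ^ N * ((t - a) ^ N * (b - t) ^ N)" for t
      by (simp flip: power_mult_distrib add: algebra_simps)
    moreover have "((\<lambda>t. (-1) ^ N * ((t - a) ^ N * (b - t) ^ N)) has_integral
        (-1) ^ N * ((b - a) ^ (N + N + 1) * (fact N * fact N / fact (N + N + 1)))) {a..b}"
      by (intro has_integral_mult_right has_integral_power_times_power ab)
    ultimately have "((\<lambda>t. ((t - a) * (t - b)) ^ N) has_integral
        (-1) ^ N * ((b - a) ^ (N + N + 1) * (fact N * fact N / fact (N + N + 1)))) {a..b}"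
      by simp
    then have "(LINT t|lborel. indicator {a..b} t * ((t - a) * (t - b)) ^ N) =
        (-1) ^ N * ((b - a) ^ (N + N + 1) * (fact N * fact N / fact (N + N + 1)))"
      by (intro LBINT_eq_has_integral continuous_intros)
    then show ?thesis using ab by (simp add: power2_eq_square mult_ac flip: mult_2)
  qed
  show ?thesis
  proof (cases "a \<le> b")
    case True
    then show ?thesis by (rule *)
  next
    case False
    then show ?thesis
      using *[of b a] by (simp add: min.commute max.commute mult.commute abs_minus_commute)
  qed
qed

lemma sum_even_indices:
  fixes f :: "nat \<Rightarrow> 'a::comm_monoid_add"
  assumes "\<And>s. odd s \<Longrightarrow> f s = 0"
  shows "(\<Sum>s\<le>2 * N. f s) = (\<Sum>k\<le>N. f (2 * k))"
  using assms by (induction N) simp_all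

text \<open>Half the integral of \<open>((t - a) * (t - b)) ^ N\<close> over \<open>{-1..1}\<close>.
  Odd powers of \<open>t\<close> integrate to zero, so only the even total degrees
  \<open>2 * k\<close> in \<open>a\<close> and \<open>b\<close> survive, with
  \<open>1 / (2 * (N - k) + 1)\<close> from the remaining power of \<open>t\<close>.\<close>

definition even_part :: "nat \<Rightarrow> real \<Rightarrow> real \<Rightarrow> real" where
  "even_part N a b = (\<Sum>k\<le>N. (\<Sum>i\<le>2 * k. real (N choose i) * real (N choose (2 * k - i)) * (a ^ i * b ^ (2 * k - i))) /
      (2 * real (N - k) + 1))"

lemma integral_power_times_power_symmetric:
  "(LINT t|lborel. indicator {-1..1} t * ((t - a) * (t - b)) ^ N) = 2 * even_part N a b"
proof -
  define c where "c s = (\<Sum>i\<le>s. real (N choose i) * real (N choose (s - i)) * (a ^ i * b ^ (s - i)))" for s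
  have pow: "((\<lambda>t::real. t ^ m) has_integral (if even m then 2 / (real m + 1) else 0)) {-1..1}" for m
    using has_integral_power_Icc[of "-1" 1 0 m] by (cases "even m") simp_all
  have "((\<lambda>t. \<Sum>s\<le>2 * N. (-1) ^ s * c s * t ^ (2 * N - s)) has_integral
     (\<Sum>s\<le>2 * N. (-1) ^ s * c s * (if even (2 * N - s) then 2 / (real (2 * N - s) + 1) else 0))) {-1..1}"
    by (intro has_integral_sum has_integral_mult_right pow) auto
  moreover have "(\<Sum>s\<le>2 * N. (-1) ^ s * c s * t ^ (2 * N - s)) = ((t - a) * (t - b)) ^ N" for t
    unfolding diff_power_times_diff_power c_def by (intro sum.cong) (auto simp: mult_ac)
  ultimately have "((\<lambda>t. ((t - a) * (t - b)) ^ N) has_integral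
     (\<Sum>s\<le>2 * N. (-1) ^ s * c s * (if even (2 * N - s) then 2 / (real (2 * N - s) + 1) else 0))) {-1..1}"
    by (simp only:)
  then have "(LINT t|lborel. indicator {-1..1} t * ((t - a) * (t - b)) ^ N) =
     (\<Sum>s\<le>2 * N. (-1) ^ s * c s * (if even (2 * N - s) then 2 / (real (2 * N - s) + 1) else 0))"
    by (intro LBINT_eq_has_integral continuous_intros)
  also have "\<dots> = (\<Sum>s\<le>2 * N. if even s then 2 * (c s / (real (2 * N - s) + 1)) else 0)"
    by (intro sum.cong) auto
  also have "\<dots> = (\<Sum>k\<le>N. 2 * (c (2 * k) / (real (2 * N - 2 * k) + 1)))"
    by (subst sum_even_indices) simp_all
  also have "\<dots> = 2 * even_part N a b"
    unfolding even_part_def sum_distrib_left[of 2] c_def diff_mult_distrib2[symmetric]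
    by (intro sum.cong refl) simp
  finally show ?thesis .
qed

text \<open>Including \<open>u = 0\<close> is right also for \<open>N = 0\<close>: the convention of
  \<open>trunc_powr\<close> there agrees with \<open>0 ^ 0 = 1\<close>.\<close>

lemma trunc_powr_of_nat: "trunc_powr u (real N) = (if u \<ge> 0 then u ^ N else 0)"
  by (auto simp: trunc_powr_def powr_realpow)

text \<open>The part of the kernel that belongs to a fixed \<open>z\<close>, after exchanging the
  integrals; \<open>a\<close> and \<open>b\<close> are the inner products with \<open>z\<close>, and
  \<open>N = M - 1\<close>.\<close>

definition ridge_integral :: "nat \<Rightarrow> real \<Rightarrow> real \<Rightarrow> real" where
  "ridge_integral N a b =
    (LINT t|lborel. indicator {-1..1} t * (trunc_powr (a - t) (real N) * trunc_powr (b - t) (real N)))"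

text \<open>
  Reflecting \<open>t\<close>, the two terms together integrate \<open>((t - a) * (t - b)) ^ N\<close> over \<open>{-1..1}\<close>
  except for the gap between \<open>a\<close> and \<open>b\<close>; the gap is the only source of the odd power.
\<close>

lemma ridge_integral_add_reflected:
  assumes a: "\<bar>a\<bar> \<le> 1" and b: "\<bar>b\<bar> \<le> 1"
  shows "ridge_integral N a b + ridge_integral N (- a) (- b) =
    2 * even_part N a b - (-1) ^ N * ((fact N)\<^sup>2 / fact (2 * N + 1)) * \<bar>a - b\<bar> ^ (2 * N + 1)"
proof -
  define p where "p t = ((t - a) * (t - b)) ^ N" for t
  have cont: "continuous_on A p" for A unfolding p_def[abs_def] by (intro continuous_intros)
  have int: "integrable lborel (\<lambda>t. indicator {l..u} t * p t)" for l u
    using borel_integrable_atLeastAtMost'[OF cont, of l u] by (simp add: set_integrable_def)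
  have tr: "trunc_powr (a' - t) (real N) * trunc_powr (b' - t) (real N) =
      (if t \<le> min a' b' then ((a' - t) * (b' - t)) ^ N else 0)" for a' b' t
    by (auto simp: trunc_powr_of_nat power_mult_distrib)
  \<comment> \<open>Both \<open>a\<close> and \<open>b\<close> lie in \<open>{-1..1}\<close>, so the
    truncation at \<open>min a b\<close> takes the place of the upper limit 1.\<close>
  have 1: "ridge_integral N a b = (LINT t|lborel. indicator {-1..min a b} t * p t)"
    unfolding ridge_integral_def tr using a b
    by (intro Bochner_Integration.integral_cong)
       (auto simp: p_def algebra_simps power_mult_distrib split: split_indicator)
  have "ridge_integral N (- a) (- b) =
      (LINT t|lborel. indicator {-1..1} (- t) * (if - t \<le> min (- a) (- b) then ((- a + t) * (- b + t)) ^ N else 0))"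
    unfolding ridge_integral_def tr
    by (subst lborel_integral_real_affine[where c = "-1" and t = 0]) (simp cong: if_cong)+
  also have "\<dots> = (LINT t|lborel. indicator {max a b..1} t * p t)"
    using a b by (intro Bochner_Integration.integral_cong)
       (auto simp: p_def split: split_indicator)
  finally have 2: "ridge_integral N (- a) (- b) = (LINT t|lborel. indicator {max a b..1} t * p t)" .
  have "(LINT t|lborel. indicator {-1..1} t * p t) =
     (LINT t|lborel. indicator {-1..min a b} t * p t + indicator {min a b..max a b} t * p t + indicator {max a b..1} t * p t)"
  proof (rule integral_cong_AE)
    have "AE t in lborel. t \<noteq> min a b" "AE t in lborel. t \<noteq> max a b"
      by (rule AE_lborel_singleton)+
    then show "AE t in lborel. indicator {-1..1} t * p t =
        indicator {-1..min a b} t * p t + indicator {min a b..max a b} t * p t + indicator {max a b..1} t * p t"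
      by eventually_elim (use a b in \<open>auto split: split_indicator\<close>)
  qed (use borel_measurable_integrable[OF int] in auto)
  also have "\<dots> = (LINT t|lborel. indicator {-1..min a b} t * p t) +
      (LINT t|lborel. indicator {min a b..max a b} t * p t) + (LINT t|lborel. indicator {max a b..1} t * p t)"
    by (simp add: int Bochner_Integration.integral_add)
  finally show ?thesis
    using integral_power_times_power_symmetric[of a b N] integral_power_times_power_between[of a b N]
    unfolding 1 2 p_def by simp
qed

section \<open>Integration over the sphere\<close>

lemma measurable_sphere_measure [measurable (raw)]:
  "f \<in> measurable borel M \<Longrightarrow> f \<in> measurable sphere_measure M"
  unfolding sphere_measure_def by (intro measurable_restrict_space1) simp

lemma integrable_sphere_measure:
  fixes f :: "'a::euclidean_space \<Rightarrow> real"
  assumes "f \<in> borel_measurable borel" "\<And>z. norm z = 1 \<Longrightarrow> \<bar>f z\<bar> \<le> B"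
  shows "integrable sphere_measure f"
proof -
  interpret prob_space "sphere_measure :: 'a measure" by (rule prob_space_sphere_measure)
  show ?thesis
    using assms by (intro integrable_const_bound[of f B] measurable_sphere_measure) auto
qed

lemma integrable_sphere_measure_continuous:
  fixes f :: "'a::euclidean_space \<Rightarrow> real"
  assumes f: "continuous_on UNIV f"
  shows "integrable sphere_measure f"
proof -
  have "compact (f ` sphere 0 1)"
    using f by (intro compact_continuous_image continuous_on_subset[OF f]) auto
  then obtain B where "\<forall>z\<in>sphere 0 1. \<bar>f z\<bar> \<le> B"
    by (auto simp: bounded_iff dest!: compact_imp_bounded)
  then show ?thesis
    using f by (intro integrable_sphere_measure[of f B] borel_measurable_continuous_onI) auto
qed

lemma nn_integral_sphere_measure_uminus:
  fixes g :: "'a::euclidean_space \<Rightarrow> ennreal"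
  assumes [measurable]: "g \<in> borel_measurable borel"
  shows "(\<integral>\<^sup>+z. g (- z) \<partial>sphere_measure) = (\<integral>\<^sup>+z. g z \<partial>sphere_measure)"
proof -
  have [measurable]: "(sgn :: 'a \<Rightarrow> 'a) \<in> borel_measurable borel" by (rule borel_measurable_sgn)
  have [measurable]: "ball (0::'a) 1 \<in> sets borel" by simp
  have "(\<integral>\<^sup>+x. g (sgn x) * indicator (ball 0 1) x \<partial>lborel) =
      (\<integral>\<^sup>+x. g (- sgn x) * indicator (ball 0 1) x \<partial>lborel)"
  proof (subst nn_integral_lborel_scaleR[of _ "-1"])
    show "(\<lambda>x. g (sgn x) * indicator (ball 0 1) x) \<in> borel_measurable borel" by measurable
  qed (auto simp: sgn_minus intro!: nn_integral_cong split: split_indicator)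
  then show ?thesis by (simp add: nn_integral_sphere_measure)
qed

text \<open>Comparing image measures transfers the symmetry to signed integrands without any
  integrability hypothesis. The image under the identity serves to place both measures on the Borel
  sets of the whole space.\<close>

lemma integral_sphere_measure_uminus:
  fixes f :: "'a::euclidean_space \<Rightarrow> real"
  assumes [measurable]: "f \<in> borel_measurable borel"
  shows "(LINT z|sphere_measure. f (- z)) = (LINT z|sphere_measure. f z)"
proof -
  have "distr sphere_measure borel uminus = distr (sphere_measure :: 'a measure) borel (\<lambda>x. x)"
  proof (rule measure_eqI)
    fix A :: "'a set" assume "A \<in> sets (distr sphere_measure borel uminus)"
    then have [measurable]: "A \<in> sets borel" by simp
    show "emeasure (distr sphere_measure borel uminus) A = emeasure (distr sphere_measure borel (\<lambda>x. x)) A"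
      using nn_integral_sphere_measure_uminus[of "indicator A"]
      by (simp add: nn_integral_distr flip: nn_integral_indicator)
  qed simp
  then have "(LINT z|distr sphere_measure borel uminus. f z) = (LINT z|distr sphere_measure borel (\<lambda>x. x). f z)"
    by simp
  then show ?thesis by (simp add: integral_distr)
qed

lemma integral_sphere_inner_abs_power:
  fixes p :: "'a::euclidean_space"
  shows "(LINT z|sphere_measure. \<bar>p \<bullet> z\<bar> ^ r) = norm p ^ r * sphere_moment DIM('a) r"
proof (cases "p = 0")
  \<comment> \<open>This case does occur: \<open>p\<close> will be \<open>x - y\<close>, possibly
    with \<open>x = y\<close>, or \<open>\<alpha> *\<^sub>R x + y\<close>. For \<open>r = 0\<close>
    it rests on \<open>0 ^ 0 = 1\<close>.\<close>
  case True
  interpret prob_space "sphere_measure :: 'a measure" by (rule prob_space_sphere_measure)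
  have "Gamma (real DIM('a) / 2) \<noteq> 0"
    by (rule less_imp_neq[symmetric], rule Gamma_real_pos) simp
  then have "sphere_moment DIM('a) 0 = 1"
    by (simp add: sphere_moment_def Gamma_one_half_real)
  then show ?thesis
    using True prob_space by (cases r) simp_all
next
  case False
  define q where "q = p /\<^sub>R norm p"
  have q: "norm q = 1" "p = norm p *\<^sub>R q" using False by (simp_all add: q_def)
  have "(LINT z|sphere_measure. \<bar>p \<bullet> z\<bar> ^ r) = (LINT z|sphere_measure. norm p ^ r * \<bar>q \<bullet> z\<bar> ^ r)"
    by (subst q(2)) (simp add: abs_mult power_mult_distrib)
  also have "\<dots> = norm p ^ r * (LINT z|sphere_measure. \<bar>q \<bullet> z\<bar> ^ r)" by simp
  also have "(LINT z|sphere_measure. \<bar>q \<bullet> z\<bar> ^ r) = sphere_moment DIM('a) r"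
  proof -
    have "sphere_moment DIM('a) r \<ge> 0"
      by (auto simp: sphere_moment_def intro!: divide_nonneg_pos mult_nonneg_nonneg mult_pos_pos less_imp_le[OF Gamma_real_pos] Gamma_real_pos add_pos_nonneg)
    then show ?thesis
      by (subst integral_eq_nn_integral) (auto simp: nn_integral_sphere_inner_unit[OF q(1)])
  qed
  finally show ?thesis .
qed

lemma sphere_moment_even:
  assumes "n > 0"
  shows "sphere_moment n (2 * k) = pochhammer (1 / 2) k / pochhammer (real n / 2) k"
proof -
  have "Gamma ((real (2 * k) + 1) / 2) = pochhammer (1 / 2) k * sqrt pi"
    using Gamma_plus_of_nat_pos[of "1 / 2" k] by (simp add: add_divide_distrib Gamma_one_half_real add.commute)
  moreover have "Gamma ((real n + real (2 * k)) / 2) = pochhammer (real n / 2) k * Gamma (real n / 2)"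
    using Gamma_plus_of_nat_pos[of "real n / 2" k] assms by (simp add: add_divide_distrib)
  moreover have "Gamma (real n / 2) > 0" using assms by (simp add: Gamma_real_pos)
  ultimately show ?thesis by (simp add: sphere_moment_def)
qed

lemma integral_sphere_inner_even_power:
  fixes p :: "'a::euclidean_space"
  shows "(LINT z|sphere_measure. (p \<bullet> z) ^ (2 * k)) =
    (norm p)\<^sup>2 ^ k * (pochhammer (1 / 2) k / pochhammer (real DIM('a) / 2) k)"
  using integral_sphere_inner_abs_power[of p "2 * k"]
  by (simp add: sphere_moment_even power_even_abs power_mult)

lemma integral_sphere_inner_odd_power:
  fixes p :: "'a::euclidean_space"
  assumes "odd k"
  shows "(LINT z|sphere_measure. (p \<bullet> z) ^ k) = 0"
proof -
  have "(LINT z|sphere_measure. (p \<bullet> z) ^ k) = (LINT z|sphere_measure. (p \<bullet> (- z)) ^ k)"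
    by (rule integral_sphere_measure_uminus[symmetric]) simp
  also have "\<dots> = - (LINT z|sphere_measure. (p \<bullet> z) ^ k)"
    using assms by simp
  finally show ?thesis by simp
qed

lemma integral_sphere_even_part:
  fixes x y :: "'a::euclidean_space"
  assumes d: "DIM('a) = d + 1" "d > 0" and x: "norm x = 1" and y: "norm y = 1"
  shows "(LINT z|sphere_measure. even_part N (x \<bullet> z) (y \<bullet> z)) = Q_kernel d (Suc N) x y"
proof -
  define m where "m i j = (LINT z|sphere_measure. (x \<bullet> z) ^ i * (y \<bullet> z) ^ j)" for i j
  have int: "integrable sphere_measure (\<lambda>z. c * ((x \<bullet> z) ^ i * (y \<bullet> z) ^ j))" for c i j
    by (intro integrable_sphere_measure_continuous continuous_intros)
  have int1: "integrable sphere_measure (\<lambda>z. (x \<bullet> z) ^ i * (y \<bullet> z) ^ j)" for i j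
    using int[of 1] by simp
  have "(LINT z|sphere_measure. even_part N (x \<bullet> z) (y \<bullet> z)) =
      (\<Sum>k\<le>N. (\<Sum>i\<le>2 * k. real (N choose i) * real (N choose (2 * k - i)) * m i (2 * k - i)) / (2 * real (N - k) + 1))"
    unfolding even_part_def m_def
  proof (subst Bochner_Integration.integral_sum)
    fix k
    have "2 * real (N - k) + 1 \<noteq> 0" by linarith
    then show "integrable sphere_measure (\<lambda>z. (\<Sum>i\<le>2 * k. real (N choose i) * real (N choose (2 * k - i)) *
        ((x \<bullet> z) ^ i * (y \<bullet> z) ^ (2 * k - i))) / (2 * real (N - k) + 1))"
      by (intro integrable_sphere_measure_continuous continuous_intros) auto
  qed (simp add: Bochner_Integration.integral_sum int1)
  also have "\<dots> = (\<Sum>n\<le>N. Q_coeff (real d) N n * ((1 - x \<bullet> y) / 2) ^ n)"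
  proof (rule moment_sum_eq_Q_coeff_sum)
    show "real d > 0" using d by simp
    fix k \<alpha>
    have "(\<Sum>i\<le>2 * k. real ((2 * k) choose i) * m i (2 * k - i) * \<alpha> ^ i) =
        (LINT z|sphere_measure. (\<Sum>i\<le>2 * k. (real ((2 * k) choose i) * \<alpha> ^ i) * ((x \<bullet> z) ^ i * (y \<bullet> z) ^ (2 * k - i))))"
      unfolding m_def
      by (subst Bochner_Integration.integral_sum, rule int, simp only: integral_mult_right_zero)
         (simp only: mult_ac)
    also have "\<dots> = (LINT z|sphere_measure. ((\<alpha> *\<^sub>R x + y) \<bullet> z) ^ (2 * k))"
      by (simp add: inner_add_left binomial_ring power_mult_distrib mult_ac)
    also have "\<dots> = (norm (\<alpha> *\<^sub>R x + y))\<^sup>2 ^ k * (pochhammer (1 / 2) k / pochhammer ((real d + 1) / 2) k)"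
      using integral_sphere_inner_even_power[of "\<alpha> *\<^sub>R x + y" k] d by (simp add: add.commute)
    \<comment> \<open>Both points have norm 1, so the squared norm is
      \<open>\<alpha>\<^sup>2 + 2 * \<alpha> * (x \<bullet> y) + 1\<close>; completing the square in
      this way singles out the variable of the polynomial.\<close>
    also have "(norm (\<alpha> *\<^sub>R x + y))\<^sup>2 = (\<alpha> + 1)\<^sup>2 - 4 * \<alpha> * ((1 - x \<bullet> y) / 2)"
      unfolding power2_norm_eq_inner using x y
      by (simp add: inner_add_left inner_add_right inner_commute norm_eq_1 power2_eq_square field_simps)
    finally show "(\<Sum>i\<le>2 * k. real ((2 * k) choose i) * m i (2 * k - i) * \<alpha> ^ i) =
        pochhammer (1 / 2) k / pochhammer ((real d + 1) / 2) k * ((\<alpha> + 1)\<^sup>2 - 4 * \<alpha> * ((1 - x \<bullet> y) / 2)) ^ k"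
      by simp
  qed
  also have "\<dots> = Q_kernel d (Suc N) x y"
    using d by (simp add: Q_kernel_expand)
  finally show ?thesis .
qed

section \<open>The kernel as an average over the sphere\<close>

lemma borel_measurable_trunc_powr_of_nat [measurable]:
  "(\<lambda>u. trunc_powr u (real N)) \<in> borel_measurable borel"
  unfolding trunc_powr_of_nat by measurable

lemma trunc_powr_of_nat_bound:
  assumes "\<bar>a\<bar> \<le> 1" "\<bar>t\<bar> \<le> 1"
  shows "\<bar>trunc_powr (a - t) (real N)\<bar> \<le> 2 ^ N"
  using assms by (auto simp: trunc_powr_of_nat intro!: power_mono)

text \<open>Fubini's theorem: on \<open>{-1..1}\<close> times the sphere the arguments of the
  truncated powers are at most 2 in absolute value, so the integrand is bounded on a set of finite
  measure.\<close>

lemma sphere_kernel_eq_ridge_integral: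
  fixes x y :: "'a::euclidean_space"
  assumes x: "norm x = 1" and y: "norm y = 1"
  shows "sphere_kernel (real (Suc N)) x y = (LINT z|sphere_measure. ridge_integral N (x \<bullet> z) (y \<bullet> z))"
proof -
  interpret S: prob_space "sphere_measure :: 'a measure" by (rule prob_space_sphere_measure)
  interpret P: pair_sigma_finite "lborel :: real measure" "sphere_measure :: 'a measure" ..
  define f where "f t z = indicator {-1..1} t * (trunc_powr (x \<bullet> z - t) (real N) * trunc_powr (y \<bullet> z - t) (real N))" for t z
  have [measurable]: "(\<lambda>z. p \<bullet> z) \<in> borel_measurable sphere_measure" for p :: 'a
    by (rule measurable_sphere_measure) simp
  have [measurable]: "(\<lambda>w. f (fst w) (snd w)) \<in> borel_measurable (lborel \<Otimes>\<^sub>M sphere_measure)"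
    unfolding f_def by measurable
  have int: "integrable (lborel \<Otimes>\<^sub>M sphere_measure) (\<lambda>(t, z). f t z)"
  proof (rule integrableI_bounded_set[where A = "{-1..1} \<times> space sphere_measure" and B = "2 ^ N * 2 ^ N"])
    show "emeasure (lborel \<Otimes>\<^sub>M (sphere_measure :: 'a measure)) ({-1..1 :: real} \<times> space sphere_measure) < \<infinity>"
    proof -
      have "emeasure (lborel \<Otimes>\<^sub>M (sphere_measure :: 'a measure)) ({-1..1 :: real} \<times> space sphere_measure) =
          emeasure lborel {-1..1 :: real} * emeasure (sphere_measure :: 'a measure) (space sphere_measure)"
        by (rule S.emeasure_pair_measure_Times) (simp, rule sets.top)
      also have "\<dots> < \<infinity>" unfolding S.emeasure_space_1 by simp
      finally show ?thesis .
    qed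
    show "AE w in lborel \<Otimes>\<^sub>M sphere_measure. w \<in> {- 1..1} \<times> space sphere_measure \<longrightarrow>
        norm (case w of (t, z) \<Rightarrow> f t z) \<le> 2 ^ N * 2 ^ N"
    proof (intro AE_I2 impI)
      fix w :: "real \<times> 'a" assume "w \<in> {- 1..1} \<times> space sphere_measure"
      then obtain t z where w: "w = (t, z)" "\<bar>t\<bar> \<le> 1" "norm z = 1" by (cases w) auto
      have "\<bar>x \<bullet> z\<bar> \<le> 1" "\<bar>y \<bullet> z\<bar> \<le> 1"
        using Cauchy_Schwarz_ineq2[of x z] Cauchy_Schwarz_ineq2[of y z] x y w by simp_all
      then have "\<bar>trunc_powr (x \<bullet> z - t) (real N) * trunc_powr (y \<bullet> z - t) (real N)\<bar> \<le> 2 ^ N * 2 ^ N"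
        unfolding abs_mult using w by (intro mult_mono trunc_powr_of_nat_bound) auto
      then show "norm (case w of (t, z) \<Rightarrow> f t z) \<le> 2 ^ N * 2 ^ N"
        by (auto simp: w f_def split: split_indicator)
    qed
    show "{-1..1 :: real} \<times> space sphere_measure \<in> sets (lborel \<Otimes>\<^sub>M (sphere_measure :: 'a measure))"
      by (rule pair_measureI) (simp, rule sets.top)
    show "AE w in lborel \<Otimes>\<^sub>M sphere_measure. w \<notin> {- 1..1} \<times> space sphere_measure \<longrightarrow>
        (case w of (t, z) \<Rightarrow> f t z) = 0"
      by (rule AE_I2) (auto simp: f_def space_pair_measure indicator_def split: if_splits)
  qed (simp add: split_beta')
  have "sphere_kernel (real (Suc N)) x y = (LINT t|lborel. LINT z|sphere_measure. f t z)"
    by (simp add: sphere_kernel_def set_lebesgue_integral_def f_def)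
  also have "\<dots> = (LINT z|sphere_measure. LINT t|lborel. f t z)"
    by (rule P.Fubini_integral[OF int, symmetric])
  also have "\<dots> = (LINT z|sphere_measure. ridge_integral N (x \<bullet> z) (y \<bullet> z))"
    by (simp add: f_def ridge_integral_def)
  finally show ?thesis .
qed

lemma borel_measurable_ridge_integral:
  "(\<lambda>z. ridge_integral N (x \<bullet> z) (y \<bullet> z)) \<in> borel_measurable (borel :: 'a::euclidean_space measure)"
  unfolding ridge_integral_def by measurable

lemma ridge_integral_bound:
  assumes "\<bar>a\<bar> \<le> 1" "\<bar>b\<bar> \<le> 1"
  shows "\<bar>ridge_integral N a b\<bar> \<le> 2 * (2 ^ N * 2 ^ N)"
proof -
  have "norm (ridge_integral N a b) \<le> (LINT t|lborel. indicator {-1..1 :: real} t * (2 ^ N * 2 ^ N :: real))"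
    unfolding ridge_integral_def
  proof (rule order_trans[OF integral_norm_bound])
    have bound: "norm (indicator {-1..1} t * (trunc_powr (a - t) (real N) * trunc_powr (b - t) (real N))) \<le>
        indicator {-1..1} t * (2 ^ N * 2 ^ N)" for t :: real
    proof -
      have "\<bar>trunc_powr (a - t) (real N) * trunc_powr (b - t) (real N)\<bar> \<le> 2 ^ N * 2 ^ N" if "\<bar>t\<bar> \<le> 1"
        unfolding abs_mult using assms that by (intro mult_mono trunc_powr_of_nat_bound) auto
      then show ?thesis by (auto split: split_indicator)
    qed
    have int: "integrable lborel (\<lambda>t. indicator {-1..1 :: real} t * (2 ^ N * 2 ^ N :: real))" by simp
    have "integrable lborel (\<lambda>t. indicator {-1..1} t * (trunc_powr (a - t) (real N) * trunc_powr (b - t) (real N)))"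
      by (rule Bochner_Integration.integrable_bound[OF int]) (use bound in auto)
    then show "(LINT t|lborel. norm (indicator {-1..1} t * (trunc_powr (a - t) (real N) * trunc_powr (b - t) (real N)))) \<le>
        (LINT t|lborel. indicator {-1..1 :: real} t * (2 ^ N * 2 ^ N))"
      by (intro integral_mono integrable_norm int bound)
  qed
  then show ?thesis by simp
qed

lemma sphere_kernel_eq:
  fixes x y :: "'a::euclidean_space"
  assumes d: "DIM('a) = d + 1" "d > 0" and x: "norm x = 1" and y: "norm y = 1"
  shows "sphere_kernel (real (Suc N)) x y = Q_kernel d (Suc N) x y -
    (-1) ^ N * ((fact N)\<^sup>2 / fact (2 * N + 1) / 2) * (norm (x - y) ^ (2 * N + 1) * sphere_moment (d + 1) (2 * N + 1))"
proof -
  let ?r = "\<lambda>z. ridge_integral N (x \<bullet> z) (y \<bullet> z)"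
  define C :: real where "C = (-1) ^ N * ((fact N)\<^sup>2 / fact (2 * N + 1))"
  have le1: "\<bar>x \<bullet> z\<bar> \<le> 1" "\<bar>y \<bullet> z\<bar> \<le> 1" if "norm z = 1" for z
    using Cauchy_Schwarz_ineq2[of x z] Cauchy_Schwarz_ineq2[of y z] x y that by simp_all
  have int: "integrable sphere_measure ?r" "integrable sphere_measure (\<lambda>z. ?r (- z))"
  proof -
    show "integrable sphere_measure ?r"
      by (rule integrable_sphere_measure[OF borel_measurable_ridge_integral ridge_integral_bound]) (auto intro: le1)
    show "integrable sphere_measure (\<lambda>z. ?r (- z))"
    proof (rule integrable_sphere_measure)
      show "(\<lambda>z. ?r (- z)) \<in> borel_measurable borel"
        using borel_measurable_ridge_integral[of N x y] by measurable
      show "\<bar>?r (- z)\<bar> \<le> 2 * (2 ^ N * 2 ^ N)" if "norm z = 1" for z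
        using le1[of "- z"] that by (intro ridge_integral_bound) auto
    qed
  qed
  \<comment> \<open>Replacing \<open>z\<close> by \<open>- z\<close> keeps the mean and changes
    \<open>a\<close>, \<open>b\<close> into \<open>- a\<close>, \<open>- b\<close>; the sum is the
    combination evaluated by \<open>ridge_integral_add_reflected\<close>.\<close>
  have "2 * sphere_kernel (real (Suc N)) x y = (LINT z|sphere_measure. ?r z) + (LINT z|sphere_measure. ?r (- z))"
    using integral_sphere_measure_uminus[OF borel_measurable_ridge_integral, of N x y]
    by (simp add: sphere_kernel_eq_ridge_integral[OF x y] del: of_nat_Suc)
  also have "\<dots> = (LINT z|sphere_measure. ?r z + ?r (- z))"
    by (rule Bochner_Integration.integral_add[OF int, symmetric])
  also have "\<dots> = (LINT z|sphere_measure. 2 * even_part N (x \<bullet> z) (y \<bullet> z) - C * \<bar>(x - y) \<bullet> z\<bar> ^ (2 * N + 1))"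
  proof (rule Bochner_Integration.integral_cong[OF refl])
    fix z :: 'a assume "z \<in> space sphere_measure"
    then have z: "norm z = 1" by simp
    show "?r z + ?r (- z) = 2 * even_part N (x \<bullet> z) (y \<bullet> z) - C * \<bar>(x - y) \<bullet> z\<bar> ^ (2 * N + 1)"
      using ridge_integral_add_reflected[OF le1[OF z], of N] by (simp add: inner_diff_left C_def)
  qed
  also have "\<dots> = 2 * (LINT z|sphere_measure. even_part N (x \<bullet> z) (y \<bullet> z)) -
      C * (LINT z|sphere_measure. \<bar>(x - y) \<bullet> z\<bar> ^ (2 * N + 1))"
  proof -
    have nz: "2 * real (N - k) + 1 \<noteq> 0" for k by linarith
    have "integrable sphere_measure (\<lambda>z. 2 * even_part N (x \<bullet> z) (y \<bullet> z))"
      "integrable sphere_measure (\<lambda>z. C * \<bar>(x - y) \<bullet> z\<bar> ^ (2 * N + 1))"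
      unfolding even_part_def
      by (intro integrable_sphere_measure_continuous continuous_intros ballI nz)+
    then show ?thesis
      by (subst Bochner_Integration.integral_diff) simp_all
  qed
  also have "\<dots> = 2 * Q_kernel d (Suc N) x y - C * (norm (x - y) ^ (2 * N + 1) * sphere_moment (d + 1) (2 * N + 1))"
    unfolding integral_sphere_even_part[OF assms] integral_sphere_inner_abs_power d(1) ..
  finally have "sphere_kernel (real (Suc N)) x y = Q_kernel d (Suc N) x y -
      C * (norm (x - y) ^ (2 * N + 1) * sphere_moment (d + 1) (2 * N + 1)) / 2"
    by linarith
  then show ?thesis by (simp add: C_def)
qed

text \<open>This is the origin of \<open>c_const\<close>: half the Beta constant of the gap times
  the absolute moment of order \<open>2 * M - 1\<close> on the sphere.\<close>

lemma half_beta_sphere_moment: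
  assumes d: "d > 0"
  shows "(fact N)\<^sup>2 / fact (2 * N + 1) / 2 * sphere_moment (d + 1) (2 * N + 1) = c_const d (Suc N)"
proof -
  define h where "h = pochhammer (1 / 2 :: real) (Suc N)"
  have h: "h > 0" by (simp add: h_def pochhammer_pos)
  \<comment> \<open>Duplication applies to \<open>(2 * N + 2)!\<close>; the last factor
    \<open>2 * (N + 1)\<close> is then split off.\<close>
  have "fact (2 * N + 1) * 2 = 4 ^ Suc N * h * (fact N :: real)"
  proof -
    have "(real N + 1) * (fact (2 * N + 1) * 2) = (fact (2 * Suc N) :: real)" by (simp add: algebra_simps)
    also have "\<dots> = 4 ^ Suc N * h * fact (Suc N)" unfolding fact_double power_mult h_def by simp
    also have "\<dots> = (real N + 1) * (4 ^ Suc N * h * fact N)" by (simp add: algebra_simps)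
    finally show ?thesis by (simp del: fact_Suc power_Suc)
  qed
  then have "(fact N)\<^sup>2 / fact (2 * N + 1) / 2 = fact N / (4 ^ Suc N * h)"
    using h by (simp add: power2_eq_square divide_simps del: fact_Suc power_Suc)
  moreover have "sphere_moment (d + 1) (2 * N + 1) =
      fact N * Gamma (real (d + 1) / 2) / (sqrt pi * (pochhammer (real d / 2) (Suc N) * Gamma (real d / 2)))"
  proof -
    have "Gamma ((real (2 * N + 1) + 1) / 2) = fact N"
      using Gamma_fact[of N, where 'a = real] by (simp add: add_divide_distrib add.commute)
    moreover have "Gamma ((real (d + 1) + real (2 * N + 1)) / 2) = pochhammer (real d / 2) (Suc N) * Gamma (real d / 2)"
      using Gamma_plus_of_nat_pos[of "real d / 2" "Suc N"] d by (simp add: add_divide_distrib add_ac del: pochhammer_Suc)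
    ultimately show ?thesis by (simp add: sphere_moment_def add.commute)
  qed
  moreover have "Gamma (real (Suc N)) = fact N"
    using Gamma_fact[of N, where 'a = real] by simp
  moreover have "2 ^ (2 * Suc N) = (4 ^ Suc N :: real)" by (simp only: power_mult) simp
  ultimately show ?thesis
    unfolding c_const_def by (simp only:) (simp add: h_def mult_ac add.commute del: pochhammer_Suc fact_Suc power_Suc)
qed

section \<open>The double integral and the main result\<close>

lemma c_const_pos:
  assumes "d > 0" "M > 0"
  shows "c_const d M > 0"
  unfolding c_const_def using assms
  by (intro mult_pos_pos divide_pos_pos Gamma_real_pos pochhammer_pos) simp_all

lemma Q_coeff_nonzero:
  assumes "x > 0" "n \<le> N"
  shows "Q_coeff x N n \<noteq> 0"
proof -
  have "pochhammer (x / 2 + 1 + real N) (N - n) > 0" "pochhammer ((x + 1) / 2) N > 0"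
    using assms by (auto intro!: pochhammer_pos)
  moreover have "2 * real (N - n) + 1 \<noteq> 0" by linarith
  moreover have "real (N choose n) \<noteq> 0" using assms by simp
  ultimately show ?thesis by (simp add: Q_coeff_def del: binomial_eq_0_iff)
qed

lemma degree_sum_monom:
  fixes c :: "nat \<Rightarrow> 'a::comm_monoid_add"
  assumes "c N \<noteq> 0"
  shows "degree (\<Sum>n\<le>N. monom (c n) n) = N"
proof (rule antisym)
  have coeff: "coeff (\<Sum>n\<le>N. monom (c n) n) k = (if k \<le> N then c k else 0)" for k
    by (simp add: coeff_sum)
  show "degree (\<Sum>n\<le>N. monom (c n) n) \<le> N" by (rule degree_le) (simp add: coeff)
  show "N \<le> degree (\<Sum>n\<le>N. monom (c n) n)" by (rule le_degree) (simp add: coeff assms)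
qed

text \<open>The degree is exactly \<open>N\<close> because the leading coefficient in
  \<open>w\<close> is nonzero and \<open>w\<close> is a nonconstant affine function of
  \<open>x \<bullet> y\<close>.\<close>

lemma Q_kernel_polynomial:
  assumes d: "d > 0"
  shows "\<exists>q :: real poly. degree q = N \<and> (\<forall>x y :: 'a::real_inner. Q_kernel d (Suc N) x y = poly q (x \<bullet> y))"
proof -
  define p where "p = (\<Sum>n\<le>N. monom (Q_coeff (real d) N n) n)"
  have "degree p = N"
    unfolding p_def using d by (intro degree_sum_monom Q_coeff_nonzero) simp_all
  then have "degree (p \<circ>\<^sub>p [:1 / 2, - 1 / 2:]) = N" by (simp add: degree_pcompose)
  moreover have "Q_kernel d (Suc N) x y = poly (p \<circ>\<^sub>p [:1 / 2, - 1 / 2:]) (x \<bullet> y)" for x y :: 'a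
    by (simp add: Q_kernel_expand[OF d] p_def poly_pcompose poly_sum poly_monom diff_divide_distrib)
  ultimately show ?thesis by blast
qed

text \<open>For \<open>n \<le> N\<close> the symbol \<open>(- N)_n\<close> is nonzero and cancels;
  beyond \<open>N\<close> it vanishes above and below, and the quotient counts as 0, so the sum
  stops at \<open>N\<close>.\<close>

lemma hypergeometric_cancelled:
  "hypergeometric [- real N, - 1 / 2 - real N, real N + x, x / 2] [- real N, (x + 1) / 2, x] z =
    (\<Sum>n\<le>N. pochhammer (- 1 / 2 - real N) n * pochhammer (real N + x) n * pochhammer (x / 2) n /
       (pochhammer ((x + 1) / 2) n * pochhammer x n * fact n) * z ^ n)"
proof -
  have "hypergeometric [- real N, - 1 / 2 - real N, real N + x, x / 2] [- real N, (x + 1) / 2, x] z =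
    (\<Sum>n\<le>N. (\<Prod>a\<leftarrow>[- real N, - 1 / 2 - real N, real N + x, x / 2]. pochhammer a n) /
      (\<Prod>b\<leftarrow>[- real N, (x + 1) / 2, x]. pochhammer b n) * z ^ n / fact n)"
    by (rule hypergeometric_terminating) simp
  also have "\<dots> = (\<Sum>n\<le>N. pochhammer (- 1 / 2 - real N) n * pochhammer (real N + x) n * pochhammer (x / 2) n /
       (pochhammer ((x + 1) / 2) n * pochhammer x n * fact n) * z ^ n)"
  proof (rule sum.cong[OF refl])
    fix n assume "n \<in> {..N}"
    then have "pochhammer (- real N) n \<noteq> 0" by (simp add: pochhammer_minus_of_nat)
    then show "(\<Prod>a\<leftarrow>[- real N, - 1 / 2 - real N, real N + x, x / 2]. pochhammer a n) /
      (\<Prod>b\<leftarrow>[- real N, (x + 1) / 2, x]. pochhammer b n) * z ^ n / fact n =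
      pochhammer (- 1 / 2 - real N) n * pochhammer (real N + x) n * pochhammer (x / 2) n /
       (pochhammer ((x + 1) / 2) n * pochhammer x n * fact n) * z ^ n"
      by (simp add: mult_ac)
  qed
  finally show ?thesis .
qed

lemma hypergeometric_cancelled_polynomial:
  assumes x: "x > 0"
  shows "\<exists>p :: real poly. degree p = N \<and>
    (\<forall>z. hypergeometric [- real N, - 1 / 2 - real N, real N + x, x / 2] [- real N, (x + 1) / 2, x] z = poly p z)"
proof -
  define c where "c n = pochhammer (- 1 / 2 - real N) n * pochhammer (real N + x) n * pochhammer (x / 2) n /
       (pochhammer ((x + 1) / 2) n * pochhammer x n * fact n)" for n
  have "c N \<noteq> 0"
  proof -
    \<comment> \<open>Being a half-integer, the negative parameter produces no zero factor; hence
      the leading coefficient is nonzero and the degree is \<open>N\<close>.\<close>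
    have "pochhammer (- 1 / 2 - real N) N = (-1) ^ N * pochhammer (3 / 2) N"
      using pochhammer_minus[of "1 / 2 + real N" N] by simp
    moreover have "pochhammer (3 / 2 :: real) N > 0" "pochhammer (real N + x) N > 0" "pochhammer (x / 2) N > 0"
      "pochhammer ((x + 1) / 2) N > 0" "pochhammer x N > 0"
      using x by (auto intro!: pochhammer_pos add_nonneg_pos)
    ultimately show ?thesis by (simp add: c_def)
  qed
  then have "degree (\<Sum>n\<le>N. monom (c n) n) = N" by (rule degree_sum_monom)
  then show ?thesis
    unfolding hypergeometric_cancelled c_def[symmetric]
    by (intro exI[of _ "\<Sum>n\<le>N. monom (c n) n"]) (simp add: poly_sum poly_monom)
qed

section \<open>Mean values of the polynomial part\<close>

lemma integral_sphere_one_minus_inner_power: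
  fixes y :: "'a::euclidean_space"
  assumes d: "DIM('a) = d + 1" "d > 0" and y: "norm y = 1"
  shows "(LINT x|sphere_measure. ((1 - x \<bullet> y) / 2) ^ n) = pochhammer (real d / 2) n / pochhammer (real d) n"
proof -
  define m where "m k = (LINT x|sphere_measure. (y \<bullet> x) ^ k)" for k
  have int: "integrable sphere_measure (\<lambda>x. c * (y \<bullet> x) ^ k)" for c k
    by (intro integrable_sphere_measure_continuous continuous_intros)
  have "(LINT x|sphere_measure. (1 - x \<bullet> y) ^ n) =
      (LINT x|sphere_measure. (\<Sum>k\<le>n. real (n choose k) * (-1) ^ k * (y \<bullet> x) ^ k))"
  proof (rule Bochner_Integration.integral_cong[OF refl])
    fix x
    show "(1 - x \<bullet> y) ^ n = (\<Sum>k\<le>n. real (n choose k) * (-1) ^ k * (y \<bullet> x) ^ k)"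
      using binomial_ring[of "- (y \<bullet> x)" 1 n] by (simp add: inner_commute power_minus[of "x \<bullet> y"] mult.assoc)
  qed
  also have "\<dots> = (\<Sum>k\<le>n. real (n choose k) * (-1) ^ k * m k)"
    unfolding m_def by (subst Bochner_Integration.integral_sum, rule int, simp only: integral_mult_right_zero)
  \<comment> \<open>One upper limit for both parities: for even \<open>n\<close> the additional term
    has a zero binomial coefficient. The top index is odd, so its moment drops out next.\<close>
  also have "\<dots> = (\<Sum>k\<le>2 * (n div 2) + 1. real (n choose k) * (-1) ^ k * m k)"
    by (rule sum.mono_neutral_left) (auto simp: binomial_eq_0)
  also have "\<dots> = (\<Sum>j\<le>n div 2. real (n choose (2 * j)) * m (2 * j))"
  proof -
    have odd: "m k = 0" if "odd k" for k
      unfolding m_def using that by (rule integral_sphere_inner_odd_power)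
    have "(\<Sum>k\<le>2 * (n div 2) + 1. real (n choose k) * (-1) ^ k * m k) =
        (\<Sum>k\<le>2 * (n div 2). real (n choose k) * (-1) ^ k * m k)"
      by (simp add: odd)
    also have "\<dots> = (\<Sum>j\<le>n div 2. real (n choose (2 * j)) * m (2 * j))"
      by (subst sum_even_indices) (simp_all add: odd)
    finally show ?thesis .
  qed
  also have "\<dots> = (\<Sum>j\<le>n div 2. real (n choose (2 * j)) * (pochhammer (1 / 2) j / pochhammer ((real d + 1) / 2) j))"
    unfolding m_def integral_sphere_inner_even_power using d y by (simp add: add.commute)
  also have "\<dots> = 2 ^ n * (pochhammer (real d / 2) n / pochhammer (real d) n)"
    using d by (intro sum_binomial_even_moments) simp
  finally show ?thesis by (simp add: power_divide)
qed

text \<open>The inner mean is the same for every unit vector \<open>y\<close>, and the outer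
  integral over a probability measure leaves it unchanged.\<close>

lemma double_integral_Q_kernel:
  assumes d: "DIM('a::euclidean_space) = d + 1" "d > 0"
  shows "(LINT y|(sphere_measure :: 'a measure). LINT x|sphere_measure. Q_kernel d (Suc N) x y) =
    (-1) ^ N * (fact N / pochhammer (3 / 2) N) *
    (\<Sum>n\<le>N. pochhammer (- 1 / 2 - real N) n * pochhammer (real N + real d) n * pochhammer (real d / 2) n /
       (pochhammer ((real d + 1) / 2) n * pochhammer (real d) n * fact n))"
proof -
  interpret prob_space "sphere_measure :: 'a measure" by (rule prob_space_sphere_measure)
  have "(LINT x|sphere_measure. Q_kernel d (Suc N) x y) =
      (\<Sum>n\<le>N. Q_coeff (real d) N n * (pochhammer (real d / 2) n / pochhammer (real d) n))"
    if "norm y = 1" for y :: 'a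
  proof -
    have int: "integrable sphere_measure (\<lambda>x. c * ((1 - x \<bullet> y) / 2) ^ k)" for c k
      by (intro integrable_sphere_measure_continuous continuous_intros) auto
    show ?thesis
      unfolding Q_kernel_expand[OF d(2)]
      by (subst Bochner_Integration.integral_sum, rule int)
         (simp only: integral_mult_right_zero integral_sphere_one_minus_inner_power[OF d that])
  qed
  then have "(LINT y|(sphere_measure :: 'a measure). LINT x|sphere_measure. Q_kernel d (Suc N) x y) =
      (LINT y|(sphere_measure :: 'a measure).
        (\<Sum>n\<le>N. Q_coeff (real d) N n * (pochhammer (real d / 2) n / pochhammer (real d) n)))"
    by (intro Bochner_Integration.integral_cong) auto
  also have "\<dots> = (\<Sum>n\<le>N. Q_coeff (real d) N n * (pochhammer (real d / 2) n / pochhammer (real d) n))"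
    using prob_space by simp
  also note sum_Q_coeff_pochhammer[of "real d" N]
  finally show ?thesis using d by simp
qed

theorem proposition5:
  fixes d M :: nat
  assumes "d \<ge> 2" and "M \<ge> 1" and "CARD('n::finite) = d + 1"
  shows
    "(\<forall>x \<in> sphere (0 :: real ^ 'n) 1. \<forall>y \<in> sphere 0 1.
        sphere_kernel (real M) x y =
          Q_kernel d M x y + (-1) ^ M * c_const d M * norm (x - y) ^ (2 * M - 1)) \<and>
     (\<exists>q :: real poly. degree q = M - 1 \<and>
        (\<forall>x \<in> sphere (0 :: real ^ 'n) 1. \<forall>y \<in> sphere 0 1. Q_kernel d M x y = poly q (x \<bullet> y))) \<and>
     0 < c_const d M \<and>
     (LINT y|(sphere_measure :: (real ^ 'n) measure). LINT x|sphere_measure. Q_kernel d M x y) =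
       (-1) ^ (M - 1) * (fact (M - 1) / pochhammer (3 / 2) (M - 1)) *
       hypergeometric [1 - real M, 1 / 2 - real M, real M + real d - 1, real d / 2]
         [1 - real M, (real d + 1) / 2, real d] 1 \<and>
     (\<exists>p :: real poly. degree p = M - 1 \<and>
        (\<forall>z. hypergeometric [1 - real M, 1 / 2 - real M, real M + real d - 1, real d / 2]
               [1 - real M, (real d + 1) / 2, real d] z = poly p z)) \<and>
     (d = 2 \<longrightarrow>
       (LINT y|(sphere_measure :: (real ^ 'n) measure). LINT x|sphere_measure. Q_kernel 2 M x y) =
         (2 * real M + 1) / 2 *
         (2 ^ (2 * M) / ((real M)\<^sup>2 * (2 * real M + 1)\<^sup>2) +
          (-1) ^ (M - 1) / (real M * (2 * real M + 1)\<^sup>2) *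
            (fact (M - 1) / pochhammer (1 / 2) M)))"
proof -
  obtain N where M: "M = Suc N" using assms(2) by (cases M) auto
  have d: "DIM(real ^ 'n) = d + 1" "d > 0" using assms by simp_all
  have params: "1 - real M = - real N" "1 / 2 - real M = - 1 / 2 - real N" "real M + real d - 1 = real N + real d"
    "M - 1 = N" "2 * M - 1 = 2 * N + 1"
    by (simp_all add: M)
  \<comment> \<open>The minus sign in front of the gap term joins \<open>(-1) ^ N\<close> to give
    \<open>(-1) ^ M\<close>.\<close>
  have kernel: "sphere_kernel (real M) x y =
      Q_kernel d M x y + (-1) ^ M * c_const d M * norm (x - y) ^ (2 * M - 1)"
    if "x \<in> sphere 0 1" "y \<in> sphere 0 1" for x y :: "real ^ 'n"
    using that sphere_kernel_eq[OF d, of x y N] half_beta_sphere_moment[OF d(2), of N, symmetric]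
    unfolding params(5) by (simp add: M mult_ac del: of_nat_Suc fact_Suc)
  have double: "(LINT y|(sphere_measure :: (real ^ 'n) measure). LINT x|sphere_measure. Q_kernel d M x y) =
       (-1) ^ N * (fact N / pochhammer (3 / 2) N) *
       hypergeometric [- real N, - 1 / 2 - real N, real N + real d, real d / 2]
         [- real N, (real d + 1) / 2, real d] 1"
    unfolding hypergeometric_cancelled M double_integral_Q_kernel[OF d] by simp
  have two: "(LINT y|(sphere_measure :: (real ^ 'n) measure). LINT x|sphere_measure. Q_kernel 2 M x y) =
         (2 * real M + 1) / 2 *
         (2 ^ (2 * M) / ((real M)\<^sup>2 * (2 * real M + 1)\<^sup>2) +
          (-1) ^ N / (real M * (2 * real M + 1)\<^sup>2) * (fact N / pochhammer (1 / 2) M))" if "d = 2"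
    using double_integral_Q_kernel[OF d, of N] sum_pochhammer_two_sphere[of N] unfolding that M by simp
  show ?thesis
    unfolding params
  proof (intro conjI impI)
    show "\<exists>q :: real poly. degree q = N \<and>
        (\<forall>x \<in> sphere (0 :: real ^ 'n) 1. \<forall>y \<in> sphere 0 1. Q_kernel d M x y = poly q (x \<bullet> y))"
      using Q_kernel_polynomial[OF d(2), of N] unfolding M by blast
    show "0 < c_const d M" using c_const_pos[of d M] d M by simp
    show "\<exists>p :: real poly. degree p = N \<and>
        (\<forall>z. hypergeometric [- real N, - 1 / 2 - real N, real N + real d, real d / 2]
               [- real N, (real d + 1) / 2, real d] z = poly p z)"
      using d by (intro hypergeometric_cancelled_polynomial) simp
    show "\<forall>x \<in> sphere (0 :: real ^ 'n) 1. \<forall>y \<in> sphere 0 1.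
        sphere_kernel (real M) x y = Q_kernel d M x y + (-1) ^ M * c_const d M * norm (x - y) ^ (2 * N + 1)"
      using kernel[unfolded params(5)] by blast
  qed (fact double two)+
qed

end
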